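(* Let $(\hbar_1,\hbar_2)\in\mathbb{k}^2$ and let $\mathcal{LL}_{2,\hbar_1,\hbar_2}$ denote the double Livernet--Loday operad at this point. For each point $(\hbar_1,\hbar_2)$ except for the origin, the operad $\mathcal{LL}_{2,\hbar_1,\hbar_2}$ is isomorphic to the operad $\mathcal{A}ss_2$. If $(\hbar_1,\hbar_2)=(0,0)$, then the operad $\mathcal{LL}_{2,\hbar_1,\hbar_2}$ is isomorphic to the bi-Hamiltonian operad $\mathcal{P}_2$.
   Context: $\mathbb{k}$ is a field of characteristic zero. The double Livernet--Loday operad $\mathcal{LL}_{2,\hbar_1,\hbar_2}$ is generated by a commutative binary operation $a,b\mapsto a\cdot b$ and two skew-commutative binary operations $a,b\mapsto\{a,b\}$ and $a,b\mapsto[a,b]$ satisfying (i) $[a\cdot b,c]=a\cdot[b,c]+[a,c]\cdot b$; (ii) $\{a\cdot b,c\}=a\cdot\{b,c\}+\{a,c\}\cdot b$; (iii) $\{a,\{b,c\}\}+\{b,\{c,a\}\}+\{c,\{a,b\}\}=0$; (iv) $[a,[b,c]]+[b,[c,a]]+[c,[a,b]]=0$; (v) $\{a,[b,c]\}+\{b,[c,a]\}+\{c,[a,b]\}+[a,\{b,c\}]+[b,\{c,a\}]+[c,\{a,b\}]=0$; (vi) $(a\cdot b)\cdot c-a\cdot(b\cdot c)=\hbar_1^2[b,[a,c]]+\hbar_1\hbar_2([b,\{a,c\}]+\{b,[a,c]\})+\hbar_2^2\{b,\{a,c\}\}$. It is defined over $\mathbb{k}[[\hbar_1,\hbar_2]]$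 with $\hbar_1,\hbar_2$ formal; the relations being polynomial, one may specialize $(\hbar_1,\hbar_2)$ to a point of $\mathbb{k}^2$ to obtain an operad over $\mathbb{k}$. The operad $\mathcal{A}ss_2$ over $\mathbb{k}$ is the quadratic operad generated by two binary operations $\star:a,b\mapsto a\star b$ (no symmetry) and $[\cdot,\cdot]:a,b\mapsto[a,b]$ with the identities $a\star(b\star c)=(a\star b)\star c$; $[a,b]+[b,a]=0$; $[a,[b,c]]+[b,[c,a]]+[c,[a,b]]=0$; $[a,b\star c+c\star b]=[a,b]\star c+b\star[a,c]+[a,c]\star b+c\star[a,b]$; $[a,b\star c-c\star b]+[b,c\star a-a\star c]+[c,a\star b-b\star a]+a\star[b,c]-[b,c]\star a+b\star[c,a]-[c,a]\star b+c\star[a,b]-[a,b]\star c=0$. The bi-Hamiltonian operad $\mathcal{P}_2$ is the operad over $\mathbb{k}$ generated by a commutative associative product and two Lie brackets $[\,,]$ and $\{\,,\}$, each satisfying the Leibniz rule with respect to the product, which are compatible, i.e. satisfy identity (v) above. *)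

theory Defs
  imports "HOL-Library.Poly_Mapping" "HOL-Combinatorics.Permutations"
begin

section \<open>Symmetric operads in modules over a commutative ring\<close>

text \<open>
  An operad has a module of operations \<open>Ops P n\<close> for each arity \<open>n\<close>. The inputs of an operation of
  arity \<open>n\<close> are numbered \<open>0, \<dots>, n - 1\<close>. The group of permutations of \<open>{..<n}\<close> acts on the left:
  in \<open>act P n \<sigma> p\<close> the input number \<open>j\<close> of \<open>p\<close> becomes the input number \<open>\<sigma> j\<close>.
  The partial composition \<open>pcomp P m n i p q\<close> inserts \<open>q\<close> (arity \<open>n\<close>) in the input \<open>i < m\<close> of \<open>p\<close>
  (arity \<open>m\<close>), giving an operation of arity \<open>m + n - 1\<close>. All fields are meaningful
  only on their carriers.
\<close>

record ('k, 'a) operad =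
  Ops :: "nat \<Rightarrow> 'a set"
  zero_op :: "nat \<Rightarrow> 'a"
  plus_op :: "nat \<Rightarrow> 'a \<Rightarrow> 'a \<Rightarrow> 'a"
  scale_op :: "nat \<Rightarrow> 'k \<Rightarrow> 'a \<Rightarrow> 'a"
  act :: "nat \<Rightarrow> (nat \<Rightarrow> nat) \<Rightarrow> 'a \<Rightarrow> 'a"
  unit_op :: 'a
  pcomp :: "nat \<Rightarrow> nat \<Rightarrow> nat \<Rightarrow> 'a \<Rightarrow> 'a \<Rightarrow> 'a"

text \<open>
  The permutation of the inputs of \<open>p \<circ>\<^sub>i q\<close> induced by a permutation \<open>\<sigma>\<close> of the \<open>m\<close> inputs of \<open>p\<close>
  and a permutation \<open>\<tau>\<close> of the \<open>n\<close> inputs of \<open>q\<close>.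
\<close>

definition perm_comp :: "nat \<Rightarrow> nat \<Rightarrow> nat \<Rightarrow> (nat \<Rightarrow> nat) \<Rightarrow> (nat \<Rightarrow> nat) \<Rightarrow> nat \<Rightarrow> nat" where
  "perm_comp m n i \<sigma> \<tau> k =
    (let place = (\<lambda>j. if \<sigma> j < \<sigma> i then \<sigma> j else \<sigma> j + n - 1) in
     if k < i then place k
     else if k < i + n then \<sigma> i + \<tau> (k - i)
     else if k < m + n - 1 then place (k + 1 - n)
     else k)"

locale operad =
  fixes P :: "('k :: comm_ring_1, 'a) operad"
  assumes zero_closed: "zero_op P n \<in> Ops P n"
    and plus_closed: "x \<in> Ops P n \<Longrightarrow> y \<in> Ops P n \<Longrightarrow> plus_op P n x y \<in> Ops P n"
    and scale_closed: "x \<in> Ops P n \<Longrightarrow> scale_op P n c x \<in> Ops P n"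
    and plus_assoc: "x \<in> Ops P n \<Longrightarrow> y \<in> Ops P n \<Longrightarrow> z \<in> Ops P n \<Longrightarrow>
      plus_op P n (plus_op P n x y) z = plus_op P n x (plus_op P n y z)"
    and plus_commute: "x \<in> Ops P n \<Longrightarrow> y \<in> Ops P n \<Longrightarrow> plus_op P n x y = plus_op P n y x"
    and zero_plus: "x \<in> Ops P n \<Longrightarrow> plus_op P n (zero_op P n) x = x"
    and plus_uminus: "x \<in> Ops P n \<Longrightarrow> plus_op P n x (scale_op P n (-1) x) = zero_op P n"
    and scale_one: "x \<in> Ops P n \<Longrightarrow> scale_op P n 1 x = x"
    and scale_scale: "x \<in> Ops P n \<Longrightarrow> scale_op P n c (scale_op P n d x) = scale_op P n (c * d) x"
    and scale_plus: "x \<in> Ops P n \<Longrightarrow> y \<in> Ops P n \<Longrightarrow>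
      scale_op P n c (plus_op P n x y) = plus_op P n (scale_op P n c x) (scale_op P n c y)"
    and plus_scale: "x \<in> Ops P n \<Longrightarrow>
      scale_op P n (c + d) x = plus_op P n (scale_op P n c x) (scale_op P n d x)"
    and act_closed: "\<sigma> permutes {..<n} \<Longrightarrow> x \<in> Ops P n \<Longrightarrow> act P n \<sigma> x \<in> Ops P n"
    and act_plus: "\<sigma> permutes {..<n} \<Longrightarrow> x \<in> Ops P n \<Longrightarrow> y \<in> Ops P n \<Longrightarrow>
      act P n \<sigma> (plus_op P n x y) = plus_op P n (act P n \<sigma> x) (act P n \<sigma> y)"
    and act_scale: "\<sigma> permutes {..<n} \<Longrightarrow> x \<in> Ops P n \<Longrightarrow>
      act P n \<sigma> (scale_op P n c x) = scale_op P n c (act P n \<sigma> x)"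
    and act_id: "x \<in> Ops P n \<Longrightarrow> act P n id x = x"
    and act_act: "\<sigma> permutes {..<n} \<Longrightarrow> \<tau> permutes {..<n} \<Longrightarrow> x \<in> Ops P n \<Longrightarrow>
      act P n \<sigma> (act P n \<tau> x) = act P n (\<sigma> \<circ> \<tau>) x"
    and unit_closed: "unit_op P \<in> Ops P 1"
    and comp_closed: "i < m \<Longrightarrow> x \<in> Ops P m \<Longrightarrow> y \<in> Ops P n \<Longrightarrow>
      pcomp P m n i x y \<in> Ops P (m + n - 1)"
    and comp_plus_left: "i < m \<Longrightarrow> x \<in> Ops P m \<Longrightarrow> x' \<in> Ops P m \<Longrightarrow> y \<in> Ops P n \<Longrightarrow>
      pcomp P m n i (plus_op P m x x') y
        = plus_op P (m + n - 1) (pcomp P m n i x y) (pcomp P m n i x' y)"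
    and comp_plus_right: "i < m \<Longrightarrow> x \<in> Ops P m \<Longrightarrow> y \<in> Ops P n \<Longrightarrow> y' \<in> Ops P n \<Longrightarrow>
      pcomp P m n i x (plus_op P n y y')
        = plus_op P (m + n - 1) (pcomp P m n i x y) (pcomp P m n i x y')"
    and comp_scale_left: "i < m \<Longrightarrow> x \<in> Ops P m \<Longrightarrow> y \<in> Ops P n \<Longrightarrow>
      pcomp P m n i (scale_op P m c x) y = scale_op P (m + n - 1) c (pcomp P m n i x y)"
    and comp_scale_right: "i < m \<Longrightarrow> x \<in> Ops P m \<Longrightarrow> y \<in> Ops P n \<Longrightarrow>
      pcomp P m n i x (scale_op P n c y) = scale_op P (m + n - 1) c (pcomp P m n i x y)"
    and unit_comp: "x \<in> Ops P n \<Longrightarrow> pcomp P 1 n 0 (unit_op P) x = x"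
    and comp_unit: "i < m \<Longrightarrow> x \<in> Ops P m \<Longrightarrow> pcomp P m 1 i x (unit_op P) = x"
    and comp_sequential: "i < l \<Longrightarrow> j < m \<Longrightarrow>
      x \<in> Ops P l \<Longrightarrow> y \<in> Ops P m \<Longrightarrow> z \<in> Ops P n \<Longrightarrow>
      pcomp P (l + m - 1) n (i + j) (pcomp P l m i x y) z
        = pcomp P l (m + n - 1) i x (pcomp P m n j y z)"
    and comp_parallel: "i < j \<Longrightarrow> j < l \<Longrightarrow>
      x \<in> Ops P l \<Longrightarrow> y \<in> Ops P m \<Longrightarrow> z \<in> Ops P n \<Longrightarrow>
      pcomp P (l + m - 1) n (j + m - 1) (pcomp P l m i x y) z
        = pcomp P (l + n - 1) m i (pcomp P l n j x z) y"
    and comp_act: "\<sigma> permutes {..<m} \<Longrightarrow> \<tau> permutes {..<n} \<Longrightarrow> i < m \<Longrightarrow>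
      x \<in> Ops P m \<Longrightarrow> y \<in> Ops P n \<Longrightarrow>
      pcomp P m n (\<sigma> i) (act P m \<sigma> x) (act P n \<tau> y)
        = act P (m + n - 1) (perm_comp m n i \<sigma> \<tau>) (pcomp P m n i x y)"

definition operad_iso ::
  "('k, 'a) operad \<Rightarrow> ('k, 'b) operad \<Rightarrow> (nat \<Rightarrow> 'a \<Rightarrow> 'b) \<Rightarrow> bool" where
  "operad_iso P Q f \<longleftrightarrow>
    (\<forall>n. bij_betw (f n) (Ops P n) (Ops Q n)) \<and>
    (\<forall>n. \<forall>x \<in> Ops P n. \<forall>y \<in> Ops P n. f n (plus_op P n x y) = plus_op Q n (f n x) (f n y)) \<and>
    (\<forall>n c. \<forall>x \<in> Ops P n. f n (scale_op P n c x) = scale_op Q n c (f n x)) \<and>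
    (\<forall>n \<sigma>. \<sigma> permutes {..<n} \<longrightarrow> (\<forall>x \<in> Ops P n. f n (act P n \<sigma> x) = act Q n \<sigma> (f n x))) \<and>
    f 1 (unit_op P) = unit_op Q \<and>
    (\<forall>m n. \<forall>i < m. \<forall>x \<in> Ops P m. \<forall>y \<in> Ops P n.
      f (m + n - 1) (pcomp P m n i x y) = pcomp Q m n i (f m x) (f n y))"

definition operad_isomorphic :: "('k, 'a) operad \<Rightarrow> ('k, 'b) operad \<Rightarrow> bool" where
  "operad_isomorphic P Q \<longleftrightarrow> (\<exists>f. operad_iso P Q f)"


section \<open>Ideals and quotients\<close>

inductive in_gen_ideal :: "('k, 'a) operad \<Rightarrow> (nat \<Rightarrow> 'a set) \<Rightarrow> nat \<Rightarrow> 'a \<Rightarrow> bool"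
  for P :: "('k, 'a) operad" and R :: "nat \<Rightarrow> 'a set" where
  base: "x \<in> R n \<Longrightarrow> in_gen_ideal P R n x"
| zero: "in_gen_ideal P R n (zero_op P n)"
| plus: "in_gen_ideal P R n x \<Longrightarrow> in_gen_ideal P R n y \<Longrightarrow> in_gen_ideal P R n (plus_op P n x y)"
| scale: "in_gen_ideal P R n x \<Longrightarrow> in_gen_ideal P R n (scale_op P n c x)"
| act: "in_gen_ideal P R n x \<Longrightarrow> \<sigma> permutes {..<n} \<Longrightarrow> in_gen_ideal P R n (act P n \<sigma> x)"
| comp_left: "in_gen_ideal P R m x \<Longrightarrow> y \<in> Ops P n \<Longrightarrow> i < m \<Longrightarrow>
    in_gen_ideal P R (m + n - 1) (pcomp P m n i x y)"
| comp_right: "x \<in> Ops P m \<Longrightarrow> in_gen_ideal P R n y \<Longrightarrow> i < m \<Longrightarrow>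
    in_gen_ideal P R (m + n - 1) (pcomp P m n i x y)"

definition gen_ideal :: "('k, 'a) operad \<Rightarrow> (nat \<Rightarrow> 'a set) \<Rightarrow> nat \<Rightarrow> 'a set" where
  "gen_ideal P R n = {x. in_gen_ideal P R n x}"

definition coset :: "('k, 'a) operad \<Rightarrow> (nat \<Rightarrow> 'a set) \<Rightarrow> nat \<Rightarrow> 'a \<Rightarrow> 'a set" where
  "coset P I n x = plus_op P n x ` I n"

text \<open>
  The structure maps of the quotient are written as unions over all representatives; for an ideal
  each of these unions is a single coset (see the lemmas below).
\<close>

definition quotient_operad ::
  "('k, 'a) operad \<Rightarrow> (nat \<Rightarrow> 'a set) \<Rightarrow> ('k, 'a set) operad" where
  "quotient_operad P I =
    \<lparr> Ops = (\<lambda>n. coset P I n ` Ops P n),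
      zero_op = (\<lambda>n. coset P I n (zero_op P n)),
      plus_op = (\<lambda>n X Y. \<Union>x\<in>X. \<Union>y\<in>Y. coset P I n (plus_op P n x y)),
      scale_op = (\<lambda>n c X. \<Union>x\<in>X. coset P I n (scale_op P n c x)),
      act = (\<lambda>n \<sigma> X. \<Union>x\<in>X. coset P I n (act P n \<sigma> x)),
      unit_op = coset P I 1 (unit_op P),
      pcomp = (\<lambda>m n i X Y. \<Union>x\<in>X. \<Union>y\<in>Y. coset P I (m + n - 1) (pcomp P m n i x y)) \<rparr>"

locale operad_ideal = operad P for P :: "('k :: comm_ring_1, 'a) operad" +
  fixes I :: "nat \<Rightarrow> 'a set"
  assumes ideal_sub: "I n \<subseteq> Ops P n"
    and ideal_zero: "zero_op P n \<in> I n"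
    and ideal_plus: "x \<in> I n \<Longrightarrow> y \<in> I n \<Longrightarrow> plus_op P n x y \<in> I n"
    and ideal_scale: "x \<in> I n \<Longrightarrow> scale_op P n c x \<in> I n"
    and ideal_act: "x \<in> I n \<Longrightarrow> \<sigma> permutes {..<n} \<Longrightarrow> act P n \<sigma> x \<in> I n"
    and ideal_comp_left: "x \<in> I m \<Longrightarrow> y \<in> Ops P n \<Longrightarrow> i < m \<Longrightarrow>
      pcomp P m n i x y \<in> I (m + n - 1)"
    and ideal_comp_right: "x \<in> Ops P m \<Longrightarrow> y \<in> I n \<Longrightarrow> i < m \<Longrightarrow>
      pcomp P m n i x y \<in> I (m + n - 1)"
begin

lemma ideal_closed: "x \<in> I n \<Longrightarrow> x \<in> Ops P n"
  using ideal_sub by blast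

lemma plus_left_commute:
  assumes "x \<in> Ops P n" "y \<in> Ops P n" "z \<in> Ops P n"
  shows "plus_op P n x (plus_op P n y z) = plus_op P n y (plus_op P n x z)"
  using assms by (metis plus_assoc plus_commute)

lemma plus_zero: "x \<in> Ops P n \<Longrightarrow> plus_op P n x (zero_op P n) = x"
  by (metis plus_commute zero_closed zero_plus)

lemma in_cosetE:
  assumes "z \<in> coset P I n x"
  obtains a where "a \<in> I n" "z = plus_op P n x a"
  using assms by (auto simp: coset_def)

lemma coset_absorb:
  assumes x: "x \<in> Ops P n" and a: "a \<in> I n"
  shows "coset P I n (plus_op P n x a) = coset P I n x"
proof (intro equalityI subsetI)
  fix z assume "z \<in> coset P I n (plus_op P n x a)"
  then obtain b where b: "b \<in> I n" "z = plus_op P n (plus_op P n x a) b"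
    by (rule in_cosetE)
  then have "z = plus_op P n x (plus_op P n a b)"
    using x a by (simp add: plus_assoc ideal_closed)
  then show "z \<in> coset P I n x"
    using a b ideal_plus by (auto simp: coset_def)
next
  fix z assume "z \<in> coset P I n x"
  then obtain b where b: "b \<in> I n" "z = plus_op P n x b"
    by (rule in_cosetE)
  define a' where "a' = scale_op P n (-1) a"
  have a': "a' \<in> I n" using a ideal_scale by (simp add: a'_def)
  have "plus_op P n (plus_op P n x a) (plus_op P n a' b)
      = plus_op P n x (plus_op P n (plus_op P n a a') b)"
    using x a a' b by (simp add: plus_assoc ideal_closed plus_closed)
  also have "\<dots> = z"
    using a b by (simp add: a'_def plus_uminus zero_plus ideal_closed)
  finally show "z \<in> coset P I n (plus_op P n x a)"
    using a' b ideal_plus by (force simp: coset_def)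
qed

lemma self_in_coset: "x \<in> Ops P n \<Longrightarrow> x \<in> coset P I n x"
  unfolding coset_def using ideal_zero plus_zero by (metis image_eqI)

lemma UN_const:
  assumes "x \<in> X" "\<And>z. z \<in> X \<Longrightarrow> F z = C"
  shows "(\<Union>z\<in>X. F z) = C"
  using assms by blast

lemma UN_const2:
  assumes "x \<in> X" "y \<in> Y" "\<And>z w. z \<in> X \<Longrightarrow> w \<in> Y \<Longrightarrow> F z w = C"
  shows "(\<Union>z\<in>X. \<Union>w\<in>Y. F z w) = C"
  using assms by blast

lemma quotient_scale:
  assumes "x \<in> Ops P n"
  shows "scale_op (quotient_operad P I) n c (coset P I n x) = coset P I n (scale_op P n c x)"
proof -
  have "coset P I n (scale_op P n c z) = coset P I n (scale_op P n c x)"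
    if "z \<in> coset P I n x" for z
  proof -
    obtain a where "a \<in> I n" "z = plus_op P n x a" using \<open>z \<in> _\<close> by (rule in_cosetE)
    then show ?thesis
      using assms by (simp add: scale_plus ideal_closed coset_absorb scale_closed ideal_scale)
  qed
  then show ?thesis
    unfolding quotient_operad_def operad.simps by (rule UN_const[OF self_in_coset[OF assms]])
qed

lemma quotient_act:
  assumes "x \<in> Ops P n" "\<sigma> permutes {..<n}"
  shows "act (quotient_operad P I) n \<sigma> (coset P I n x) = coset P I n (act P n \<sigma> x)"
proof -
  have "coset P I n (act P n \<sigma> z) = coset P I n (act P n \<sigma> x)"
    if "z \<in> coset P I n x" for z
  proof -
    obtain a where "a \<in> I n" "z = plus_op P n x a" using \<open>z \<in> _\<close> by (rule in_cosetE)
    then show ?thesis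
      using assms by (simp add: act_plus ideal_closed coset_absorb act_closed ideal_act)
  qed
  then show ?thesis
    unfolding quotient_operad_def operad.simps by (rule UN_const[OF self_in_coset[OF assms(1)]])
qed

lemma quotient_plus:
  assumes x: "x \<in> Ops P n" and y: "y \<in> Ops P n"
  shows "plus_op (quotient_operad P I) n (coset P I n x) (coset P I n y)
    = coset P I n (plus_op P n x y)"
proof -
  have "coset P I n (plus_op P n z w) = coset P I n (plus_op P n x y)"
    if z: "z \<in> coset P I n x" and w: "w \<in> coset P I n y" for z w
  proof -
    obtain a b where ab: "a \<in> I n" "b \<in> I n" "z = plus_op P n x a" "w = plus_op P n y b"
      using z w by (metis in_cosetE)
    then have "plus_op P n z w = plus_op P n (plus_op P n x y) (plus_op P n a b)"
      using x y by (simp add: plus_assoc plus_left_commute ideal_closed plus_closed)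
    then show ?thesis
      using x y ab by (simp add: coset_absorb plus_closed ideal_plus)
  qed
  then show ?thesis
    unfolding quotient_operad_def operad.simps
    by (rule UN_const2[OF self_in_coset[OF x] self_in_coset[OF y]])
qed

lemma quotient_pcomp:
  assumes x: "x \<in> Ops P m" and y: "y \<in> Ops P n" and i: "i < m"
  shows "pcomp (quotient_operad P I) m n i (coset P I m x) (coset P I n y)
    = coset P I (m + n - 1) (pcomp P m n i x y)"
proof -
  have "coset P I (m + n - 1) (pcomp P m n i z w) = coset P I (m + n - 1) (pcomp P m n i x y)"
    if z: "z \<in> coset P I m x" and w: "w \<in> coset P I n y" for z w
  proof -
    obtain a b where ab: "a \<in> I m" "b \<in> I n" "z = plus_op P m x a" "w = plus_op P n y b"
      using z w by (metis in_cosetE)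
    then have "pcomp P m n i z w =
        plus_op P (m + n - 1)
          (plus_op P (m + n - 1) (pcomp P m n i x y) (pcomp P m n i a y)) (pcomp P m n i z b)"
      using x y i by (simp add: comp_plus_left comp_plus_right ideal_closed plus_closed)
    moreover have "pcomp P m n i a y \<in> I (m + n - 1)" "pcomp P m n i z b \<in> I (m + n - 1)"
      using x y i ab
      by (simp_all add: ideal_comp_left ideal_comp_right plus_closed ideal_closed del: One_nat_def)
    ultimately show ?thesis
      using x y i by (simp add: coset_absorb plus_closed comp_closed ideal_closed del: One_nat_def)
  qed
  then show ?thesis
    unfolding quotient_operad_def operad.simps
    by (rule UN_const2[OF self_in_coset[OF x] self_in_coset[OF y]])
qed

lemma quotient_simps:
  "Ops (quotient_operad P I) n = coset P I n ` Ops P n"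
  "zero_op (quotient_operad P I) n = coset P I n (zero_op P n)"
  "unit_op (quotient_operad P I) = coset P I 1 (unit_op P)"
  by (simp_all add: quotient_operad_def)

end

lemma perm_comp_permutes:
  assumes \<sigma>: "\<sigma> permutes {..<m}" and \<tau>: "\<tau> permutes {..<n}" and i: "i < m"
  shows "perm_comp m n i \<sigma> \<tau> permutes {..<m + n - 1}"
proof (rule bij_imp_permutes)
  let ?p = "perm_comp m n i \<sigma> \<tau>"
  have s: "\<sigma> j < m" if "j < m" for j using permutes_in_image[OF \<sigma>, of j] that by simp
  have t: "\<tau> j < n" if "j < n" for j using permutes_in_image[OF \<tau>, of j] that by simp
  have s_eq: "\<sigma> j = \<sigma> k \<longleftrightarrow> j = k" for j k using permutes_inj[OF \<sigma>] by (simp add: inj_eq)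
  have t_eq: "\<tau> j = \<tau> k \<longleftrightarrow> j = k" for j k using permutes_inj[OF \<tau>] by (simp add: inj_eq)
  have inj: "inj_on ?p {..<m + n - 1}"
  proof (rule inj_onI)
    fix k l assume k: "k \<in> {..<m + n - 1}" and l: "l \<in> {..<m + n - 1}" and eq: "?p k = ?p l"
    define side where "side = (\<lambda>k. i \<le> k \<and> k < i + n)"
    define inp where "inp = (\<lambda>k. if k < i then k else k + 1 - n)"
    have outer: "?p k = (if \<sigma> (inp k) < \<sigma> i then \<sigma> (inp k) else \<sigma> (inp k) + n - 1) \<and> \<sigma> (inp k) \<noteq> \<sigma> i"
      if "\<not> side k" "k < m + n - 1" for k
      using that unfolding perm_comp_def side_def inp_def s_eq by (auto simp: Let_def)
    have inner: "?p k = \<sigma> i + \<tau> (k - i) \<and> \<tau> (k - i) < n" if "side k" for k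
      using that t[of "k - i"] unfolding perm_comp_def side_def by (auto simp: Let_def)
    consider "side k" "side l" | "side k" "\<not> side l" | "\<not> side k" "side l" | "\<not> side k" "\<not> side l"
      by blast
    then show "k = l"
    proof cases
      case 1
      then have "\<tau> (k - i) = \<tau> (l - i)" using inner[of k] inner[of l] eq by simp
      then have "k - i = l - i" by (simp add: t_eq)
      then show ?thesis using 1 by (auto simp: side_def)
    next
      case 2
      then show ?thesis using inner[of k] outer[of l] eq l by (auto split: if_splits)
    next
      case 3
      then show ?thesis using inner[of l] outer[of k] eq k by (auto split: if_splits)
    next
      case 4
      then have "\<sigma> (inp k) = \<sigma> (inp l)"
        using outer[of k] outer[of l] eq k l by (auto split: if_splits)
      then have "inp k = inp l" by (simp add: s_eq)
      then show ?thesis using 4 k l by (auto simp: inp_def side_def split: if_splits)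
    qed
  qed
  have sub: "?p k < m + n - 1" if k: "k < m + n - 1" for k
  proof -
    have "\<sigma> i < m" using s i .
    moreover have "\<sigma> (k + 1 - n) < m" if "\<not> k < i + n" using that k by (intro s) auto
    moreover have "\<sigma> k < m \<and> \<sigma> k \<noteq> \<sigma> i" if "k < i" using that i by (auto intro: s simp: s_eq)
    moreover have "\<sigma> (k + 1 - n) \<noteq> \<sigma> i" if "\<not> k < i + n" using that by (auto simp: s_eq)
    moreover have "\<tau> (k - i) < n" if "\<not> k < i" "k < i + n" using that by (intro t) auto
    ultimately show ?thesis using k unfolding perm_comp_def Let_def by (auto simp: not_less)
  qed
  then have "?p ` {..<m + n - 1} \<subseteq> {..<m + n - 1}" by auto
  with inj show "bij_betw ?p {..<m + n - 1} {..<m + n - 1}"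
    by (simp add: bij_betw_def endo_inj_surj)
  show "?p k = k" if "k \<notin> {..<m + n - 1}" for k
    using that i by (auto simp: perm_comp_def Let_def)
qed

lemma (in operad_ideal) operad_quotient: "operad (quotient_operad P I)"
proof
  fix l m n i j c d and \<sigma> \<tau> :: "nat \<Rightarrow> nat"
  note q = quotient_simps quotient_scale quotient_act quotient_plus quotient_pcomp
  note cl = zero_closed plus_closed scale_closed act_closed unit_closed comp_closed
  let ?Q = "quotient_operad P I"
  show "zero_op ?Q n \<in> Ops ?Q n" by (simp add: q cl)
  show "unit_op ?Q \<in> Ops ?Q 1" using unit_closed by (simp add: q)
  {
    fix x y z x' y'
    {
      assume *: "x \<in> Ops ?Q n"
      show "scale_op ?Q n c x \<in> Ops ?Q n" using * by (auto simp: q cl)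
      show "plus_op ?Q n (zero_op ?Q n) x = x" using * by (auto simp: q cl zero_plus)
      show "plus_op ?Q n x (scale_op ?Q n (-1) x) = zero_op ?Q n"
        using * by (auto simp: q cl plus_uminus)
      show "scale_op ?Q n 1 x = x" using * by (auto simp: q cl scale_one)
      show "scale_op ?Q n c (scale_op ?Q n d x) = scale_op ?Q n (c * d) x"
        using * by (auto simp: q cl scale_scale)
      show "scale_op ?Q n (c + d) x = plus_op ?Q n (scale_op ?Q n c x) (scale_op ?Q n d x)"
        using * by (auto simp: q cl plus_scale)
      show "act ?Q n id x = x" using * by (auto simp: q cl act_id permutes_id)
      show "pcomp ?Q 1 n 0 (unit_op ?Q) x = x"
        using * unit_closed quotient_pcomp[of "unit_op P" 1] by (auto simp: q unit_comp[simplified])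
      assume "\<sigma> permutes {..<n}" note * = * this
      show "act ?Q n \<sigma> x \<in> Ops ?Q n" using * by (auto simp: q cl)
      show "act ?Q n \<sigma> (scale_op ?Q n c x) = scale_op ?Q n c (act ?Q n \<sigma> x)"
        using * by (auto simp: q cl act_scale)
      assume "\<tau> permutes {..<n}" note * = * this
      show "act ?Q n \<sigma> (act ?Q n \<tau> x) = act ?Q n (\<sigma> \<circ> \<tau>) x"
        using * by (auto simp: q cl act_act permutes_compose)
    }
    {
      assume *: "x \<in> Ops ?Q n" "y \<in> Ops ?Q n"
      show "plus_op ?Q n x y \<in> Ops ?Q n" using * by (auto simp: q cl)
      show "plus_op ?Q n x y = plus_op ?Q n y x" using * by (auto simp: q cl plus_commute)
      show "scale_op ?Q n c (plus_op ?Q n x y) = plus_op ?Q n (scale_op ?Q n c x) (scale_op ?Q n c y)"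
        using * by (auto simp: q cl scale_plus)
      show "\<sigma> permutes {..<n} \<Longrightarrow>
        act ?Q n \<sigma> (plus_op ?Q n x y) = plus_op ?Q n (act ?Q n \<sigma> x) (act ?Q n \<sigma> y)"
        using * by (auto simp: q cl act_plus)
      show "z \<in> Ops ?Q n \<Longrightarrow>
        plus_op ?Q n (plus_op ?Q n x y) z = plus_op ?Q n x (plus_op ?Q n y z)"
        using * by (auto simp: q cl plus_assoc)
    }
    show "i < m \<Longrightarrow> x \<in> Ops ?Q m \<Longrightarrow> pcomp ?Q m 1 i x (unit_op ?Q) = x"
      using quotient_pcomp[OF _ unit_closed, of _ m i] by (auto simp: q comp_unit[simplified])
    {
      assume *: "i < m" "x \<in> Ops ?Q m" "y \<in> Ops ?Q n"
      show "pcomp ?Q m n i x y \<in> Ops ?Q (m + n - 1)"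
        using * by (auto simp: q intro!: imageI comp_closed simp del: One_nat_def)
      show "pcomp ?Q m n i (scale_op ?Q m c x) y = scale_op ?Q (m + n - 1) c (pcomp ?Q m n i x y)"
        using * comp_closed[of i m _ _ n] by (auto simp: q cl comp_scale_left)
      show "pcomp ?Q m n i x (scale_op ?Q n c y) = scale_op ?Q (m + n - 1) c (pcomp ?Q m n i x y)"
        using * comp_closed[of i m _ _ n] by (auto simp: q cl comp_scale_right)
      show "x' \<in> Ops ?Q m \<Longrightarrow> pcomp ?Q m n i (plus_op ?Q m x x') y
          = plus_op ?Q (m + n - 1) (pcomp ?Q m n i x y) (pcomp ?Q m n i x' y)"
        using * comp_closed[of i m _ _ n] by (auto simp: q cl comp_plus_left)
      show "y' \<in> Ops ?Q n \<Longrightarrow> pcomp ?Q m n i x (plus_op ?Q n y y')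
          = plus_op ?Q (m + n - 1) (pcomp ?Q m n i x y) (pcomp ?Q m n i x y')"
        using * comp_closed[of i m _ _ n] by (auto simp: q cl comp_plus_right)
    }
    {
      assume *: "i < l" "j < m" "x \<in> Ops ?Q l" "y \<in> Ops ?Q m" "z \<in> Ops ?Q n"
      then have **: "i + j < l + m - 1" "l + m - 1 + n - 1 = l + (m + n - 1) - 1" by auto
      show "pcomp ?Q (l + m - 1) n (i + j) (pcomp ?Q l m i x y) z
          = pcomp ?Q l (m + n - 1) i x (pcomp ?Q m n j y z)"
        using * ** comp_closed[of i l _ _ m] comp_closed[of j m _ _ n] comp_sequential[of i l j m]
        by (auto simp: q simp del: diff_diff_left One_nat_def)
    }
    {
      assume *: "i < j" "j < l" "x \<in> Ops ?Q l" "y \<in> Ops ?Q m" "z \<in> Ops ?Q n"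
      then have **: "j + m - 1 < l + m - 1" "i < l" "i < l + n - 1"
        "l + n - 1 + m - 1 = l + m - 1 + n - 1" by auto
      show "pcomp ?Q (l + m - 1) n (j + m - 1) (pcomp ?Q l m i x y) z
          = pcomp ?Q (l + n - 1) m i (pcomp ?Q l n j x z) y"
        using * ** comp_closed[of i l _ _ m] comp_closed[of j l _ _ n] comp_parallel[of i j l]
        by (auto simp: q simp del: diff_diff_left One_nat_def)
    }
    {
      assume *: "\<sigma> permutes {..<m}" "\<tau> permutes {..<n}" "i < m" "x \<in> Ops ?Q m" "y \<in> Ops ?Q n"
      then have **: "\<sigma> i < m" "perm_comp m n i \<sigma> \<tau> permutes {..<m + n - 1}"
        using perm_comp_permutes permutes_in_image[of \<sigma> "{..<m}" i] by auto
      show "pcomp ?Q m n (\<sigma> i) (act ?Q m \<sigma> x) (act ?Q n \<tau> y)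
          = act ?Q (m + n - 1) (perm_comp m n i \<sigma> \<tau>) (pcomp ?Q m n i x y)"
        using * ** comp_closed[of i m _ _ n] comp_act[of \<sigma> m \<tau> n i]
        by (auto simp: q cl simp del: diff_diff_left One_nat_def)
    }
  }
qed

lemma (in operad) operad_ideal_gen_ideal:
  assumes "\<And>n. R n \<subseteq> Ops P n"
  shows "operad_ideal P (gen_ideal P R)"
proof unfold_locales
  fix n show "gen_ideal P R n \<subseteq> Ops P n"
  proof
    fix x assume "x \<in> gen_ideal P R n"
    then have "in_gen_ideal P R n x" by (simp add: gen_ideal_def)
    then show "x \<in> Ops P n"
      using assms
      by induction (auto intro: zero_closed plus_closed scale_closed act_closed comp_closed
          simp del: One_nat_def)
  qed
qed (auto simp: gen_ideal_def simp del: One_nat_def intro: in_gen_ideal.intros)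


section \<open>Free operads on binary operations\<close>

text \<open>
  The operations of arity \<open>n\<close> of the free operad on a set of binary operations without symmetries
  are linear combinations of planar binary trees with inner nodes labelled by the generators and
  leaves labelled bijectively by \<open>0, \<dots>, n - 1\<close>, i.e. of multilinear nonassociative monomials.
  A commutative (skew-commutative) generator of an operad is expressed by imposing the relation
  \<open>f(a, b) = f(b, a)\<close> (\<open>f(a, b) = -f(b, a)\<close>) along with the other identities.
\<close>

datatype 'g tree = Leaf nat | Node 'g "'g tree" "'g tree"

primrec leaves :: "'g tree \<Rightarrow> nat list" where
  "leaves (Leaf j) = [j]"
| "leaves (Node g s t) = leaves s @ leaves t"

primrec subst :: "(nat \<Rightarrow> 'g tree) \<Rightarrow> 'g tree \<Rightarrow> 'g tree" where
  "subst h (Leaf j) = h j"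
| "subst h (Node g s t) = Node g (subst h s) (subst h t)"

definition trees :: "nat \<Rightarrow> 'g tree set" where
  "trees n = {t. distinct (leaves t) \<and> set (leaves t) = {..<n}}"

definition relabel :: "(nat \<Rightarrow> nat) \<Rightarrow> 'g tree \<Rightarrow> 'g tree" where
  "relabel \<sigma> = subst (\<lambda>j. Leaf (\<sigma> j))"

definition graft :: "nat \<Rightarrow> nat \<Rightarrow> 'g tree \<Rightarrow> 'g tree \<Rightarrow> 'g tree" where
  "graft n i s t = subst (\<lambda>j. if j < i then Leaf j
                              else if j = i then relabel (\<lambda>k. i + k) t
                              else Leaf (j + n - 1)) s"

definition monom :: "'b \<Rightarrow> 'b \<Rightarrow>\<^sub>0 'k :: comm_ring_1" where
  "monom t = Poly_Mapping.single t 1"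

definition scale :: "'k :: comm_ring_1 \<Rightarrow> ('b \<Rightarrow>\<^sub>0 'k) \<Rightarrow> ('b \<Rightarrow>\<^sub>0 'k)" where
  "scale c p = Poly_Mapping.map (\<lambda>d. c * d) p"

definition extend_linear :: "('b \<Rightarrow> 'c \<Rightarrow>\<^sub>0 'k :: comm_ring_1) \<Rightarrow> ('b \<Rightarrow>\<^sub>0 'k) \<Rightarrow> ('c \<Rightarrow>\<^sub>0 'k)" where
  "extend_linear f p = (\<Sum>t\<in>Poly_Mapping.keys p. scale (Poly_Mapping.lookup p t) (f t))"

definition extend_bilinear ::
  "('b \<Rightarrow> 'c \<Rightarrow> 'd \<Rightarrow>\<^sub>0 'k :: comm_ring_1) \<Rightarrow> ('b \<Rightarrow>\<^sub>0 'k) \<Rightarrow> ('c \<Rightarrow>\<^sub>0 'k) \<Rightarrow> ('d \<Rightarrow>\<^sub>0 'k)" where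
  "extend_bilinear f p q = extend_linear (\<lambda>s. extend_linear (f s) q) p"

definition free_operad :: "('k :: comm_ring_1, 'g tree \<Rightarrow>\<^sub>0 'k) operad" where
  "free_operad =
    \<lparr> Ops = (\<lambda>n. {p. Poly_Mapping.keys p \<subseteq> trees n}),
      zero_op = (\<lambda>n. 0),
      plus_op = (\<lambda>n. (+)),
      scale_op = (\<lambda>n. scale),
      act = (\<lambda>n \<sigma>. extend_linear (\<lambda>t. monom (relabel \<sigma> t))),
      unit_op = monom (Leaf 0),
      pcomp = (\<lambda>m n i. extend_bilinear (\<lambda>s t. monom (graft n i s t))) \<rparr>"

definition presented_operad ::
  "(nat \<Rightarrow> ('g tree \<Rightarrow>\<^sub>0 'k :: comm_ring_1) set) \<Rightarrow> ('k, ('g tree \<Rightarrow>\<^sub>0 'k) set) operad" where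
  "presented_operad R = quotient_operad free_operad (gen_ideal free_operad R)"

lemma lookup_scale [simp]: "Poly_Mapping.lookup (scale c p) t = c * Poly_Mapping.lookup p t"
  unfolding scale_def by transfer (simp add: when_def)

lemma scale_simps [simp]:
  "scale c 0 = 0" "scale 0 p = 0" "scale 1 p = p" "scale c (scale d p) = scale (c * d) p"
  by (auto intro!: poly_mapping_eqI simp: mult.assoc)

lemma scale_add: "scale c (p + q) = scale c p + scale c q" "scale (c + d) p = scale c p + scale d p"
  by (auto intro!: poly_mapping_eqI simp: lookup_add algebra_simps)

lemma scale_sum: "scale c (sum f A) = (\<Sum>a\<in>A. scale c (f a))"
  by (induction A rule: infinite_finite_induct) (auto simp: scale_add)

lemma keys_scale: "Poly_Mapping.keys (scale c p) \<subseteq> Poly_Mapping.keys p"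
  by (auto simp: in_keys_iff)

lemma keys_monom [simp]: "Poly_Mapping.keys (monom t :: _ \<Rightarrow>\<^sub>0 'k :: comm_ring_1) = {t}"
  by (simp add: monom_def)

lemma extend_linear_superset:
  assumes "finite A" "Poly_Mapping.keys p \<subseteq> A"
  shows "extend_linear f p = (\<Sum>t\<in>A. scale (Poly_Mapping.lookup p t) (f t))"
  unfolding extend_linear_def
  by (rule sum.mono_neutral_left) (use assms in \<open>auto simp: in_keys_iff\<close>)

lemma extend_linear_monom [simp]: "extend_linear f (monom t) = f t"
  by (simp add: extend_linear_def) (simp add: monom_def)

lemma extend_linear_zero [simp]: "extend_linear f 0 = 0"
  by (simp add: extend_linear_def)

lemma extend_linear_add: "extend_linear f (p + q) = extend_linear f p + extend_linear f q"
proof -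
  let ?A = "Poly_Mapping.keys p \<union> Poly_Mapping.keys q"
  have "Poly_Mapping.keys (p + q) \<subseteq> ?A" by (rule Poly_Mapping.keys_add)
  then show ?thesis
    by (simp add: extend_linear_superset[of ?A] lookup_add scale_add sum.distrib)
qed

lemma extend_linear_scale: "extend_linear f (scale c p) = scale c (extend_linear f p)"
  by (subst extend_linear_superset[of "Poly_Mapping.keys p"])
     (auto simp: extend_linear_def scale_sum keys_scale)

lemma keys_extend_linear:
  assumes "\<And>t. t \<in> Poly_Mapping.keys p \<Longrightarrow> Poly_Mapping.keys (f t) \<subseteq> A"
  shows "Poly_Mapping.keys (extend_linear f p) \<subseteq> A"
  unfolding extend_linear_def using assms keys_scale by (fastforce dest: subsetD[OF keys_sum])

definition is_linear :: "(('b \<Rightarrow>\<^sub>0 'k :: comm_ring_1) \<Rightarrow> ('c \<Rightarrow>\<^sub>0 'k)) \<Rightarrow> bool" where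
  "is_linear F \<longleftrightarrow> (\<forall>p q. F (p + q) = F p + F q) \<and> (\<forall>c p. F (scale c p) = scale c (F p))"

lemma is_linear_id [intro]: "is_linear (\<lambda>p. p)"
  by (simp add: is_linear_def)

lemma is_linear_extend [intro]: "is_linear H \<Longrightarrow> is_linear (\<lambda>p. extend_linear f (H p))"
  by (simp add: is_linear_def extend_linear_add extend_linear_scale)

lemma is_linear_extend_fun [intro]:
  assumes "\<And>s. is_linear (\<lambda>q. g s q)"
  shows "is_linear (\<lambda>q. extend_linear (\<lambda>s. g s q) p)"
  using assms
  by (auto simp: is_linear_def extend_linear_def scale_add sum.distrib scale_sum mult.commute)

lemma linear_eqI:
  assumes F: "is_linear F" and G: "is_linear G"
    and eq: "\<And>t. t \<in> Poly_Mapping.keys p \<Longrightarrow> F (monom t) = G (monom t)"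
  shows "F p = G p"
proof -
  have exp: "H p = (\<Sum>t\<in>Poly_Mapping.keys p. scale (Poly_Mapping.lookup p t) (H (monom t)))"
    if H: "is_linear H" for H :: "_ \<Rightarrow> 'c \<Rightarrow>\<^sub>0 'b"
  proof -
    have H0: "H 0 = 0" using H unfolding is_linear_def by (metis scale_simps(2))
    have Hsum: "H (sum f A) = (\<Sum>a\<in>A. H (f a))" for f :: "'a \<Rightarrow> _" and A
      using H H0 by (induction A rule: infinite_finite_induct) (auto simp: is_linear_def)
    have "p = (\<Sum>t\<in>Poly_Mapping.keys p. scale (Poly_Mapping.lookup p t) (monom t))"
      by (rule poly_mapping_eqI)
         (auto simp: lookup_sum monom_def lookup_single when_def in_keys_iff if_distrib cong: if_cong)
    then have "H p = H (\<Sum>t\<in>Poly_Mapping.keys p. scale (Poly_Mapping.lookup p t) (monom t))"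
      by simp
    then show ?thesis using H by (simp add: Hsum is_linear_def)
  qed
  show ?thesis using exp[OF F] exp[OF G] eq by simp
qed

lemma subst_subst: "subst h (subst h' t) = subst (\<lambda>j. subst h (h' j)) t"
  by (induction t) auto

lemma subst_cong: "(\<And>j. j \<in> set (leaves t) \<Longrightarrow> h j = h' j) \<Longrightarrow> subst h t = subst h' t"
  by (induction t) auto

lemma subst_Leaf: "(\<And>j. j \<in> set (leaves t) \<Longrightarrow> h j = Leaf j) \<Longrightarrow> subst h t = t"
  by (induction t) auto

lemma leaves_subst: "leaves (subst h t) = concat (map (\<lambda>j. leaves (h j)) (leaves t))"
  by (induction t) auto

lemma leaves_relabel [simp]: "leaves (relabel \<sigma> t) = map \<sigma> (leaves t)"
  unfolding relabel_def by (induction t) auto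

lemma relabel_in_trees:
  assumes "\<sigma> permutes {..<n}" "t \<in> trees n"
  shows "relabel \<sigma> t \<in> trees n"
  using assms permutes_image[OF assms(1)] permutes_inj_on[OF assms(1)]
  by (auto simp: trees_def distinct_map)

lemma length_leaves: "t \<in> trees n \<Longrightarrow> length (leaves t) = n"
  using distinct_card[of "leaves t"] by (auto simp: trees_def)

lemma graft_in_trees:
  assumes s: "s \<in> trees m" and t: "t \<in> trees n" and i: "i < m"
  shows "graft n i s t \<in> trees (m + n - 1)"
proof -
  let ?h = "\<lambda>j. if j < i then Leaf j else if j = i then relabel (\<lambda>k. i + k) t else Leaf (j + n - 1)"
  have S: "set (leaves s) = {..<m}" "distinct (leaves s)" and T: "set (leaves t) = {..<n}"
    using s t by (auto simp: trees_def)
  have "length (leaves (graft n i s t)) = (\<Sum>j\<leftarrow>leaves s. length (leaves (?h j)))"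
    by (simp add: graft_def leaves_subst length_concat comp_def)
  also have "\<dots> = (\<Sum>j<m. length (leaves (?h j)))"
    using S by (simp add: sum_list_distinct_conv_sum_set)
  also have "\<dots> = length (leaves (?h i)) + (\<Sum>j\<in>{..<m} - {i}. length (leaves (?h j)))"
    using i by (subst sum.remove[of _ i]) auto
  also have "(\<Sum>j\<in>{..<m} - {i}. length (leaves (?h j))) = (\<Sum>j\<in>{..<m} - {i}. 1)"
    by (rule sum.cong) auto
  also have "length (leaves (?h i)) + \<dots> = m + n - 1"
    using i length_leaves[OF t] by simp
  finally have len: "length (leaves (graft n i s t)) = m + n - 1" .
  have "set (leaves (graft n i s t)) = (\<Union>j<m. set (leaves (?h j)))"
    by (simp only: graft_def leaves_subst set_concat set_map S image_image)
  also have "\<dots> = {..<m + n - 1}"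
  proof (intro equalityI subsetI)
    fix k assume "k \<in> (\<Union>j<m. set (leaves (?h j)))"
    then obtain j where j: "j < m" "k \<in> set (leaves (?h j))" by blast
    consider "j < i" | "j = i" | "i < j" by linarith
    then show "k \<in> {..<m + n - 1}"
    proof cases
      case 1 then show ?thesis using i j by simp
    next
      case 2
      then obtain l where "l \<in> set (leaves t)" "k = i + l" using j by auto
      then show ?thesis using i T by simp
    next
      case 3 then show ?thesis using j by simp
    qed
  next
    fix k assume k: "k \<in> {..<m + n - 1}"
    consider "k < i" | "i \<le> k" "k < i + n" | "i + n \<le> k" by linarith
    then show "k \<in> (\<Union>j<m. set (leaves (?h j)))"
    proof cases
      case 1 then show ?thesis using i by (intro UN_I[of k]) auto
    next
      case 2
      then have "k - i \<in> set (leaves t)" "k = i + (k - i)" using T by auto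
      then have "k \<in> (\<lambda>k. i + k) ` set (leaves t)" by (rule image_eqI[rotated])
      then show ?thesis using i by (intro UN_I[of i]) simp_all
    next
      case 3 then show ?thesis using i k by (intro UN_I[of "k + 1 - n"]) auto
    qed
  qed
  finally have set: "set (leaves (graft n i s t)) = {..<m + n - 1}" .
  then have "distinct (leaves (graft n i s t))"
    using len by (intro card_distinct) simp
  with set show ?thesis by (simp add: trees_def)
qed

lemma perm_comp_outer_less:
  "j < i \<Longrightarrow> perm_comp m n i \<sigma> \<tau> j = (if \<sigma> j < \<sigma> i then \<sigma> j else \<sigma> j + n - 1)"
  by (simp add: perm_comp_def)

lemma perm_comp_inner: "k < n \<Longrightarrow> perm_comp m n i \<sigma> \<tau> (i + k) = \<sigma> i + \<tau> k"
  by (simp add: perm_comp_def)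

lemma perm_comp_outer_greater:
  assumes "i < j" "j < m"
  shows "perm_comp m n i \<sigma> \<tau> (j + n - 1) = (if \<sigma> j < \<sigma> i then \<sigma> j else \<sigma> j + n - 1)"
proof -
  have "j + n - 1 + 1 - n = j" "\<not> j + n - 1 < i + n" "\<not> j + n - 1 < i" "j + n - 1 < m + n - 1"
    using assms by arith+
  then show ?thesis unfolding perm_comp_def Let_def by (simp only: if_True if_False)
qed

lemma graft_Leaf:
  "j < i \<Longrightarrow> graft n i (Leaf j) t = Leaf j"
  "graft n i (Leaf i) t = relabel (\<lambda>k. i + k) t"
  "i < j \<Longrightarrow> graft n i (Leaf j) t = Leaf (j + n - 1)"
  by (simp_all add: graft_def)

lemma graft_subst:
  "graft n i (subst h s) t = subst (\<lambda>j. graft n i (h j) t) s"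
  by (simp add: graft_def subst_subst)

lemma graft_relabel:
  "graft n i (relabel \<sigma> s) t = subst (\<lambda>j. graft n i (Leaf (\<sigma> j)) t) s"
  by (simp add: relabel_def graft_subst)

lemma relabel_graft_Leaf:
  "relabel \<rho> (graft n i s t) = subst (\<lambda>j. relabel \<rho> (graft n i (Leaf j) t)) s"
  by (simp add: relabel_def graft_def subst_subst)

lemma relabel_graft:
  assumes s: "s \<in> trees m" and t: "t \<in> trees n" and \<sigma>: "\<sigma> permutes {..<m}"
  shows "graft n (\<sigma> i) (relabel \<sigma> s) (relabel \<tau> t) = relabel (perm_comp m n i \<sigma> \<tau>) (graft n i s t)"
proof -
  have S: "j < m" if "j \<in> set (leaves s)" for j using s that by (auto simp: trees_def)
  have T: "k < n" if "k \<in> set (leaves t)" for k using t that by (auto simp: trees_def)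
  have eq: "\<sigma> j = \<sigma> k \<longleftrightarrow> j = k" for j k using permutes_inj[OF \<sigma>] by (simp add: inj_eq)
  have inner: "relabel (\<lambda>k. \<sigma> i + k) (relabel \<tau> t) = relabel (perm_comp m n i \<sigma> \<tau>) (relabel (\<lambda>k. i + k) t)"
    unfolding relabel_def subst_subst
    by (rule subst_cong) (simp add: perm_comp_inner T)
  show ?thesis
    unfolding graft_relabel
  proof (subst relabel_graft_Leaf, rule subst_cong, goal_cases)
    case (1 j)
    then have j: "j < m" by (rule S)
    consider "j < i" | "j = i" | "i < j" by linarith
    then show ?case
    proof cases
      case 1
      then have "\<sigma> j \<noteq> \<sigma> i" by (simp add: eq)
      with 1 show ?thesis
        by (cases "\<sigma> j < \<sigma> i") (simp_all add: graft_Leaf relabel_def perm_comp_outer_less)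
    next
      case 2
      then show ?thesis using inner by (simp add: graft_Leaf)
    next
      case 3
      then have "\<sigma> j \<noteq> \<sigma> i" by (simp add: eq)
      with 3 show ?thesis
        using perm_comp_outer_greater[OF 3 j, of n \<sigma> \<tau>]
        by (cases "\<sigma> j < \<sigma> i") (simp_all add: graft_Leaf relabel_def)
    qed
  qed
qed

lemma graft_sequential:
  assumes y: "y \<in> trees m" and j: "j < m"
  shows "graft n (i + j) (graft m i x y) z = graft (m + n - 1) i x (graft n j y z)"
proof -
  have inner: "graft n (i + j) (relabel (\<lambda>k. i + k) y) z = relabel (\<lambda>k. i + k) (graft n j y z)"
    unfolding graft_relabel
    unfolding graft_def relabel_def subst_subst
  proof (rule subst_cong, goal_cases)
    case (1 k)
    consider "k < j" | "k = j" | "j < k" by linarith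
    then show ?case by cases (simp_all add: subst_subst add.assoc)
  qed
  show ?thesis
    unfolding graft_def[of m] graft_def[of "m + n - 1"] graft_subst
  proof (rule subst_cong, goal_cases)
    case (1 k)
    consider "k < i" | "k = i" | "i < k" by linarith
    then show ?case
    proof cases
      case 3
      then have "i + j < k + m - 1" "k + m - 1 + n - 1 = k + (m + n - 1) - 1" using j by arith+
      then show ?thesis using 3 by (simp add: graft_Leaf)
    qed (simp_all add: graft_Leaf inner)
  qed
qed

lemma graft_parallel:
  assumes y: "y \<in> trees m" and ij: "i < j"
  shows "graft n (j + m - 1) (graft m i x y) z = graft m i (graft n j x z) y"
proof -
  have Y: "k < m" if "k \<in> set (leaves y)" for k using y that by (auto simp: trees_def)
  have inner_y: "graft n (j + m - 1) (relabel (\<lambda>k. i + k) y) z = relabel (\<lambda>k. i + k) y"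
    unfolding graft_relabel unfolding relabel_def
    by (rule subst_cong) (use ij in \<open>auto dest!: Y intro!: graft_Leaf(1)\<close>)
  have inner_z: "graft m i (relabel (\<lambda>k. j + k) z) y = relabel (\<lambda>k. j + m - 1 + k) z"
    unfolding graft_relabel unfolding relabel_def
  proof (rule subst_cong, goal_cases)
    case (1 k)
    have "i < j + k" "j + k + m - 1 = j + m - 1 + k" using ij by arith+
    then show ?case by (simp add: graft_Leaf)
  qed
  show ?thesis
    unfolding graft_def[of _ _ x] graft_subst
  proof (rule subst_cong, goal_cases)
    case (1 k)
    consider "k < i" | "k = i" | "i < k" "k < j" | "k = j" | "j < k" by linarith
    then show ?case
    proof cases
      case 1
      then show ?thesis using ij by (simp add: graft_Leaf)
    next
      case 2
      then show ?thesis using ij inner_y by (simp add: graft_Leaf)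
    next
      case 3
      then have "k + m - 1 < j + m - 1" using ij by arith
      then show ?thesis using 3 by (simp add: graft_Leaf)
    next
      case 4
      then show ?thesis using ij inner_z graft_Leaf(2)[of n "j + m - 1" z] by simp
    next
      case 5
      then have "j + m - 1 < k + m - 1" "i < k + n - 1" "k + m - 1 + n - 1 = k + n - 1 + m - 1"
        using ij by arith+
      then show ?thesis using 5 ij by (simp add: graft_Leaf)
    qed
  qed
qed

lemma operad_free: "operad (free_operad :: ('k :: comm_ring_1, 'g tree \<Rightarrow>\<^sub>0 'k) operad)"
proof
  fix l m n i j :: nat and \<sigma> \<tau> :: "nat \<Rightarrow> nat" and c d :: 'k
  let ?F = "free_operad :: ('k, 'g tree \<Rightarrow>\<^sub>0 'k) operad"
  note f = free_operad_def extend_bilinear_def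
  show "zero_op ?F n \<in> Ops ?F n" by (simp add: f)
  show "unit_op ?F \<in> Ops ?F 1" by (auto simp: f trees_def)
  fix x y z x' y' :: "'g tree \<Rightarrow>\<^sub>0 'k"
  {
    assume *: "x \<in> Ops ?F n"
    show "scale_op ?F n c x \<in> Ops ?F n" using * keys_scale[of c x] by (auto simp: f)
    show "plus_op ?F n (zero_op ?F n) x = x" by (simp add: f)
    show "plus_op ?F n x (scale_op ?F n (-1) x) = zero_op ?F n"
      by (auto simp: f lookup_add intro!: poly_mapping_eqI)
    show "scale_op ?F n 1 x = x" by (simp add: f)
    show "scale_op ?F n c (scale_op ?F n d x) = scale_op ?F n (c * d) x" by (simp add: f)
    show "scale_op ?F n (c + d) x = plus_op ?F n (scale_op ?F n c x) (scale_op ?F n d x)"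
      by (simp add: f scale_add)
    show "act ?F n id x = x"
      unfolding f by simp (rule linear_eqI[where p = x]; auto simp: relabel_def subst_Leaf)
    show "pcomp ?F 1 n 0 (unit_op ?F) x = x"
      unfolding f by simp (rule linear_eqI[where p = x]; auto simp: graft_def relabel_def subst_Leaf)
    assume \<sigma>: "\<sigma> permutes {..<n}"
    show "act ?F n \<sigma> x \<in> Ops ?F n"
      unfolding f
      by (simp, rule keys_extend_linear) (use * relabel_in_trees[OF \<sigma>] in \<open>auto simp: f\<close>)
    show "act ?F n \<sigma> (scale_op ?F n c x) = scale_op ?F n c (act ?F n \<sigma> x)"
      by (simp add: f extend_linear_scale)
  }
  {
    assume *: "x \<in> Ops ?F n" "y \<in> Ops ?F n"
    show "plus_op ?F n x y \<in> Ops ?F n"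
      using * Poly_Mapping.keys_add[of x y] by (auto simp: f)
    show "plus_op ?F n x y = plus_op ?F n y x" by (simp add: f add.commute)
    show "scale_op ?F n c (plus_op ?F n x y) = plus_op ?F n (scale_op ?F n c x) (scale_op ?F n c y)"
      by (simp add: f scale_add)
    show "act ?F n \<sigma> (plus_op ?F n x y) = plus_op ?F n (act ?F n \<sigma> x) (act ?F n \<sigma> y)"
      by (simp add: f extend_linear_add)
    show "plus_op ?F n (plus_op ?F n x y) z = plus_op ?F n x (plus_op ?F n y z)"
      by (simp add: f add.assoc)
  }
  show "pcomp ?F m 1 i x (unit_op ?F) = x"
    unfolding f by simp (rule linear_eqI[where p = x]; auto simp: graft_def relabel_def subst_Leaf)
  have lin1: "is_linear (\<lambda>x. pcomp ?F m n i x y)" and lin2: "is_linear (\<lambda>y. pcomp ?F m n i x y)"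
    for m n i and x y :: "'g tree \<Rightarrow>\<^sub>0 'k"
    unfolding f by (simp, (rule is_linear_extend_fun is_linear_extend is_linear_id)+)+
  have lin1': "is_linear H \<Longrightarrow> is_linear (\<lambda>x. pcomp ?F m n i (H x) y)"
    and lin2': "is_linear H \<Longrightarrow> is_linear (\<lambda>y. pcomp ?F m n i x (H y))"
    for m n i and x y :: "'g tree \<Rightarrow>\<^sub>0 'k" and H :: "('g tree \<Rightarrow>\<^sub>0 'k) \<Rightarrow> _"
    using lin1 lin2 by (simp_all add: is_linear_def)
  have lin3: "is_linear (act ?F n \<sigma>)" for n \<sigma>
    unfolding f by (simp, (rule is_linear_extend_fun is_linear_extend is_linear_id)+)+
  have lin3': "is_linear H \<Longrightarrow> is_linear (\<lambda>x. act ?F n \<sigma> (H x))"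
    for n \<sigma> and H :: "('g tree \<Rightarrow>\<^sub>0 'k) \<Rightarrow> _"
    using lin3 by (simp add: is_linear_def)
  note lin = lin1 lin2 lin1' lin2' lin3 lin3' is_linear_id
  have pcm: "pcomp ?F m n i (monom s) (monom t) = monom (graft n i s t)" for m n i s t
    by (simp add: f)
  have actm: "act ?F n \<sigma> (monom s) = monom (relabel \<sigma> s)" for n \<sigma> s
    by (simp add: f)
  show "act ?F n \<sigma> (act ?F n \<tau> x) = act ?F n (\<sigma> \<circ> \<tau>) x"
  proof (rule linear_eqI[where p = x], goal_cases)
    case (3 t)
    show ?case unfolding actm by (simp add: relabel_def subst_subst)
  qed (intro lin)+
  have ops: "x \<in> Ops ?F n \<Longrightarrow> t \<in> Poly_Mapping.keys x \<Longrightarrow> t \<in> trees n" for x n t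
    by (auto simp: f)
  {
    assume *: "i < m" "x \<in> Ops ?F m" "y \<in> Ops ?F n"
    show "pcomp ?F m n i x y \<in> Ops ?F (m + n - 1)"
      unfolding f
      by (simp, intro keys_extend_linear)
         (use * graft_in_trees[of _ m _ n i] in \<open>auto dest: ops\<close>)
  }
  show "pcomp ?F m n i (scale_op ?F m c x) y = scale_op ?F (m + n - 1) c (pcomp ?F m n i x y)"
    using lin1[of m n i y] by (simp add: is_linear_def free_operad_def)
  show "pcomp ?F m n i x (scale_op ?F n c y) = scale_op ?F (m + n - 1) c (pcomp ?F m n i x y)"
    using lin2[of m n i x] by (simp add: is_linear_def free_operad_def)
  show "pcomp ?F m n i (plus_op ?F m x x') y
      = plus_op ?F (m + n - 1) (pcomp ?F m n i x y) (pcomp ?F m n i x' y)"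
    using lin1[of m n i y] by (simp add: is_linear_def free_operad_def)
  show "pcomp ?F m n i x (plus_op ?F n y y')
      = plus_op ?F (m + n - 1) (pcomp ?F m n i x y) (pcomp ?F m n i x y')"
    using lin2[of m n i x] by (simp add: is_linear_def free_operad_def)
  {
    assume *: "i < l" "j < m" "x \<in> Ops ?F l" "y \<in> Ops ?F m" "z \<in> Ops ?F n"
    show "pcomp ?F (l + m - 1) n (i + j) (pcomp ?F l m i x y) z
        = pcomp ?F l (m + n - 1) i x (pcomp ?F m n j y z)"
    proof (rule linear_eqI[where p = x], goal_cases)
      case (3 r)
      show ?case
      proof (rule linear_eqI[where p = y], goal_cases)
        case (3 s)
        show ?case
        proof (rule linear_eqI[where p = z], goal_cases)
          case (3 t)
          show ?case using 3 \<open>s \<in> _\<close> * ops graft_sequential[of s m j n i r t] unfolding pcm by metis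
        qed (intro lin)+
      qed (intro lin)+
    qed (intro lin)+
  }
  {
    assume *: "i < j" "j < l" "x \<in> Ops ?F l" "y \<in> Ops ?F m" "z \<in> Ops ?F n"
    show "pcomp ?F (l + m - 1) n (j + m - 1) (pcomp ?F l m i x y) z
        = pcomp ?F (l + n - 1) m i (pcomp ?F l n j x z) y"
    proof (rule linear_eqI[where p = x], goal_cases)
      case (3 r)
      show ?case
      proof (rule linear_eqI[where p = y], goal_cases)
        case (3 s)
        show ?case
        proof (rule linear_eqI[where p = z], goal_cases)
          case (3 t)
          show ?case using 3 \<open>s \<in> _\<close> * ops graft_parallel[of s m i j n r t] unfolding pcm by metis
        qed (intro lin)+
      qed (intro lin)+
    qed (intro lin)+
  }
  {
    assume *: "\<sigma> permutes {..<m}" "\<tau> permutes {..<n}" "i < m" "x \<in> Ops ?F m" "y \<in> Ops ?F n"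
    show "pcomp ?F m n (\<sigma> i) (act ?F m \<sigma> x) (act ?F n \<tau> y)
        = act ?F (m + n - 1) (perm_comp m n i \<sigma> \<tau>) (pcomp ?F m n i x y)"
    proof (rule linear_eqI[where p = x], goal_cases)
      case (3 r)
      show ?case
      proof (rule linear_eqI[where p = y], goal_cases)
        case (3 s)
        show ?case
          using 3 \<open>r \<in> _\<close> * ops relabel_graft[of r m s n \<sigma> i \<tau>] unfolding pcm actm by metis
      qed (intro lin)+
    qed (intro lin)+
  }
qed

lemma operad_presented:
  assumes "\<And>n. R n \<subseteq> Ops free_operad n"
  shows "operad (presented_operad R)"
  unfolding presented_operad_def
  by (intro operad_ideal.operad_quotient operad.operad_ideal_gen_ideal operad_free assms)


section \<open>The operads\<close>

text \<open>
  Identities between operations are elements of the free operad; \<open>var 0\<close>, \<open>var 1\<close>, \<open>var 2\<close> stand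
  for the arguments \<open>a\<close>, \<open>b\<close>, \<open>c\<close>, and \<open>app g\<close> is the bilinear operation on nonassociative
  polynomials given by the generator \<open>g\<close>.
\<close>

definition var :: "nat \<Rightarrow> 'g tree \<Rightarrow>\<^sub>0 'k :: comm_ring_1" where
  "var j = monom (Leaf j)"

definition app :: "'g \<Rightarrow> ('g tree \<Rightarrow>\<^sub>0 'k :: comm_ring_1) \<Rightarrow> ('g tree \<Rightarrow>\<^sub>0 'k) \<Rightarrow> ('g tree \<Rightarrow>\<^sub>0 'k)" where
  "app g = extend_bilinear (\<lambda>s t. monom (Node g s t))"

text \<open>
  The generators stand for \<open>a \<cdot> b\<close>, \<open>{a, b}\<close> and \<open>[a, b]\<close>. In \<open>LL h1 h2\<close> the parameters are elements
  of the ground ring, so taking \<open>k[[h\<^sub>1, h\<^sub>2]]\<close> as ground ring and the formal variables as parameters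
  gives the formal operad, and taking parameters in \<open>k\<close> gives its specializations.
\<close>

datatype pois_gen = Dot | Brace | Brack

definition LL_rels :: "'k :: comm_ring_1 \<Rightarrow> 'k \<Rightarrow> nat \<Rightarrow> (pois_gen tree \<Rightarrow>\<^sub>0 'k) set" where
  "LL_rels h1 h2 n =
    (let a = var 0; b = var 1; c = var 2; D = app Dot; P = app Brace; L = app Brack in
     if n = 2 then
      { D a b - D b a,
        P a b + P b a,
        L a b + L b a }
     else if n = 3 then
      { L (D a b) c - (D a (L b c) + D (L a c) b),
        P (D a b) c - (D a (P b c) + D (P a c) b),
        P a (P b c) + P b (P c a) + P c (P a b),
        L a (L b c) + L b (L c a) + L c (L a b),
        P a (L b c) + P b (L c a) + P c (L a b) + L a (P b c) + L b (P c a) + L c (P a b),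
        D (D a b) c - D a (D b c)
          - (scale (h1\<^sup>2) (L b (L a c))
             + scale (h1 * h2) (L b (P a c) + P b (L a c))
             + scale (h2\<^sup>2) (P b (P a c))) }
     else {})"

definition LL :: "'k :: comm_ring_1 \<Rightarrow> 'k \<Rightarrow> ('k, (pois_gen tree \<Rightarrow>\<^sub>0 'k) set) operad" where
  "LL h1 h2 = presented_operad (LL_rels h1 h2)"

definition P2_rels :: "nat \<Rightarrow> (pois_gen tree \<Rightarrow>\<^sub>0 'k :: comm_ring_1) set" where
  "P2_rels n =
    (let a = var 0; b = var 1; c = var 2; D = app Dot; P = app Brace; L = app Brack in
     if n = 2 then
      { D a b - D b a,
        P a b + P b a,
        L a b + L b a }
     else if n = 3 then
      { D (D a b) c - D a (D b c),
        L a (L b c) + L b (L c a) + L c (L a b),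
        P a (P b c) + P b (P c a) + P c (P a b),
        L (D a b) c - (D a (L b c) + D (L a c) b),
        P (D a b) c - (D a (P b c) + D (P a c) b),
        P a (L b c) + P b (L c a) + P c (L a b) + L a (P b c) + L b (P c a) + L c (P a b) }
     else {})"

definition P2 :: "('k :: comm_ring_1, (pois_gen tree \<Rightarrow>\<^sub>0 'k) set) operad" where
  "P2 = presented_operad P2_rels"

text \<open>The generators stand for \<open>a \<star> b\<close> and \<open>[a, b]\<close>.\<close>

datatype ass2_gen = Star | Bracket

definition Ass2_rels :: "nat \<Rightarrow> (ass2_gen tree \<Rightarrow>\<^sub>0 'k :: comm_ring_1) set" where
  "Ass2_rels n =
    (let a = var 0; b = var 1; c = var 2; S = app Star; L = app Bracket in
     if n = 2 then
      { L a b + L b a }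
     else if n = 3 then
      { S a (S b c) - S (S a b) c,
        L a (L b c) + L b (L c a) + L c (L a b),
        L a (S b c + S c b) - (S (L a b) c + S b (L a c) + S (L a c) b + S c (L a b)),
        L a (S b c - S c b) + L b (S c a - S a c) + L c (S a b - S b a)
          + S a (L b c) - S (L b c) a + S b (L c a) - S (L c a) b + S c (L a b) - S (L a b) c }
     else {})"

definition Ass2 :: "('k :: comm_ring_1, (ass2_gen tree \<Rightarrow>\<^sub>0 'k) set) operad" where
  "Ass2 = presented_operad Ass2_rels"

lemma app_monom: "app g (monom s) (monom t) = monom (Node g s t)"
  by (simp add: app_def extend_bilinear_def)

lemma app_add:
  "app g (p + p') q = app g p q + app g p' q" "app g p (q + q') = app g p q + app g p q'"
proof -
  have "is_linear (app g p)"
    unfolding app_def extend_bilinear_def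
    by (rule is_linear_extend_fun is_linear_extend is_linear_id)+
  then show "app g p (q + q') = app g p q + app g p q'" by (simp add: is_linear_def)
qed (simp add: app_def extend_bilinear_def extend_linear_add)

lemma app_diff: "app g p (q - q') = app g p q - app g p q'"
  using app_add(2)[of g p "q - q'" q'] by simp

lemma free_operad_closed:
  "p \<in> Ops free_operad n \<Longrightarrow> q \<in> Ops free_operad n \<Longrightarrow> p + q \<in> Ops free_operad n"
  "p \<in> Ops free_operad n \<Longrightarrow> q \<in> Ops free_operad n \<Longrightarrow> p - q \<in> Ops free_operad n"
  "p \<in> Ops free_operad n \<Longrightarrow> scale d p \<in> Ops free_operad n"
  "t \<in> trees n \<Longrightarrow> monom t \<in> Ops free_operad n"
  using Poly_Mapping.keys_add[of p q] keys_diff[of p q] keys_scale[of d p]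
  by (auto simp: free_operad_def)

lemma rels_in_free_operad:
  "LL_rels h1 h2 n \<subseteq> Ops free_operad n"
  "P2_rels n \<subseteq> Ops free_operad n"
  "Ass2_rels n \<subseteq> Ops free_operad n"
proof -
  have *: "{..<2::nat} = {0, 1}" "{..<3::nat} = {0, 1, 2}" by auto
  note rels = LL_rels_def P2_rels_def Ass2_rels_def Let_def var_def app_monom app_add app_diff
  show "LL_rels h1 h2 n \<subseteq> Ops free_operad n" "P2_rels n \<subseteq> Ops free_operad n"
    "Ass2_rels n \<subseteq> Ops free_operad n"
    unfolding rels by (auto intro!: free_operad_closed simp: trees_def *)
qed

theorem operad_LL: "operad (LL h1 h2)" and operad_P2: "operad P2" and operad_Ass2: "operad Ass2"
  unfolding LL_def P2_def Ass2_def by (intro operad_presented rels_in_free_operad)+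

end

(*
  The bracket <a,b> = h1 [a,b] + h2 {a,b} is again a Lie bracket satisfying the Leibniz rule, and (vi)
  reads (a.b).c - a.(b.c) = <b,<a,c>>. This says exactly that a * b = a.b + <a,b> is associative: the
  terms linear in <,> cancel by the Leibniz rule, the quadratic ones by the Jacobi identity. If (h1,h2)
  is not zero, choose a second combination of the two brackets independent of <,>; together with * it
  satisfies the identities of Ass_2. Conversely . and <,> are half the symmetrization and half the
  commutator of *, and linear algebra gives back [,] and {,}. These mutually inverse changes of
  generators extend to the free operads and map relations to consequences of relations.
*)
theory Submission
  imports Defs HOL.Vector_Spaces
begin

section \<open>Homomorphisms and quotients\<close>

text \<open>Symmetries of generators are imposed as relations in a free operad on operations without
  symmetry. Hence the two changes of generators are not inverse bijections of free operads: on the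
  Livernet-Loday side their composite is the identity only modulo the ideal. The isomorphism is
  therefore built on quotients, from homomorphisms (\<open>operad_iso\<close> with closure in place
  of bijectivity) that respect the ideals. Identities (iii)-(v) imply the Jacobi identity for every
  combination of the two brackets, which is why any second independent combination will do. For an
  associative product the commutator is a derivation, and the associator of the product (xy + yx)/2
  is a quarter of the double commutator [y,[x,z]]; this classical identity is (vi) for half the
  commutator. The halves are where characteristic zero enters.\<close>

definition operad_hom ::
  "('k, 'a) operad \<Rightarrow> ('k, 'b) operad \<Rightarrow> (nat \<Rightarrow> 'a \<Rightarrow> 'b) \<Rightarrow> bool" where
  "operad_hom P Q f \<longleftrightarrow>
    (\<forall>n. \<forall>x \<in> Ops P n. f n x \<in> Ops Q n) \<and>
    (\<forall>n. \<forall>x \<in> Ops P n. \<forall>y \<in> Ops P n. f n (plus_op P n x y) = plus_op Q n (f n x) (f n y)) \<and>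
    (\<forall>n c. \<forall>x \<in> Ops P n. f n (scale_op P n c x) = scale_op Q n c (f n x)) \<and>
    (\<forall>n \<sigma>. \<sigma> permutes {..<n} \<longrightarrow> (\<forall>x \<in> Ops P n. f n (act P n \<sigma> x) = act Q n \<sigma> (f n x))) \<and>
    f 1 (unit_op P) = unit_op Q \<and>
    (\<forall>m n. \<forall>i < m. \<forall>x \<in> Ops P m. \<forall>y \<in> Ops P n.
      f (m + n - 1) (pcomp P m n i x y) = pcomp Q m n i (f m x) (f n y))"

lemma operad_homD:
  assumes "operad_hom P Q f"
  shows "x \<in> Ops P n \<Longrightarrow> f n x \<in> Ops Q n"
    and "x \<in> Ops P n \<Longrightarrow> y \<in> Ops P n \<Longrightarrow> f n (plus_op P n x y) = plus_op Q n (f n x) (f n y)"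
    and "x \<in> Ops P n \<Longrightarrow> f n (scale_op P n c x) = scale_op Q n c (f n x)"
    and "\<sigma> permutes {..<n} \<Longrightarrow> x \<in> Ops P n \<Longrightarrow> f n (act P n \<sigma> x) = act Q n \<sigma> (f n x)"
    and "f 1 (unit_op P) = unit_op Q"
    and "i < m \<Longrightarrow> x \<in> Ops P m \<Longrightarrow> y \<in> Ops P n \<Longrightarrow>
      f (m + n - 1) (pcomp P m n i x y) = pcomp Q m n i (f m x) (f n y)"
  using assms unfolding operad_hom_def by (simp_all del: One_nat_def)

lemma operad_hom_comp:
  assumes f: "operad_hom P Q f" and g: "operad_hom Q R g"
  shows "operad_hom P R (\<lambda>n x. g n (f n x))"
  unfolding operad_hom_def by (simp add: operad_homD[OF f] operad_homD[OF g] del: One_nat_def)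

text \<open>\<open>operad_hom\<close> does not list the zero; it is preserved because 0 = 0 + (-1) 0
  is sent to y + (-1) y, which is zero in \<open>Q\<close>.\<close>

lemma operad_hom_zero:
  assumes "operad P" "operad Q" and f: "operad_hom P Q f"
  shows "f n (zero_op P n) = zero_op Q n"
proof -
  have 0: "zero_op P n \<in> Ops P n" using assms(1) by (rule operad.zero_closed)
  then have "zero_op P n = plus_op P n (zero_op P n) (scale_op P n (-1) (zero_op P n))"
    using operad.plus_uminus[OF assms(1)] by simp
  then have "f n (zero_op P n) = plus_op Q n (f n (zero_op P n)) (scale_op Q n (-1) (f n (zero_op P n)))"
    using operad_homD(2,3)[OF f] 0 operad.scale_closed[OF assms(1)] by metis
  then show ?thesis
    using operad.plus_uminus[OF assms(2)] operad_homD(1)[OF f 0] by simp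
qed

text \<open>The preimage of an ideal under a homomorphism is an ideal, so checking generators is
  enough. The homomorphism laws hold only on carriers, hence the appeal to
  \<open>I.ideal_closed\<close> in the induction.\<close>

lemma operad_hom_gen_ideal:
  assumes P: "operad P" and Q: "operad Q" and f: "operad_hom P Q f"
    and R: "\<And>n. R n \<subseteq> Ops P n" "\<And>n x. x \<in> R n \<Longrightarrow> f n x \<in> gen_ideal Q S n"
    and x: "x \<in> gen_ideal P R n"
  shows "f n x \<in> gen_ideal Q S n"
proof -
  interpret I: operad_ideal P "gen_ideal P R"
    by (rule operad.operad_ideal_gen_ideal[OF P R(1)])
  have "in_gen_ideal P R n x" using x by (simp add: gen_ideal_def)
  then show ?thesis
  proof induction
    case (base x n)
    then show ?case by (rule R)
  next
    case (zero n)
    show ?case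
      unfolding operad_hom_zero[OF P Q f] gen_ideal_def by (auto intro: in_gen_ideal.zero)
  next
    case (comp_left m x y n i)
    then have "x \<in> Ops P m" using I.ideal_closed by (simp add: gen_ideal_def)
    then show ?case
      using comp_left operad_homD[OF f]
      by (simp add: gen_ideal_def in_gen_ideal.comp_left del: One_nat_def)
  next
    case (comp_right x m n y i)
    then have "y \<in> Ops P n" using I.ideal_closed by (simp add: gen_ideal_def)
    then show ?case
      using comp_right operad_homD[OF f]
      by (simp add: gen_ideal_def in_gen_ideal.comp_right del: One_nat_def)
  next
    case (plus n x y)
    then have "x \<in> Ops P n" "y \<in> Ops P n" using I.ideal_closed by (simp_all add: gen_ideal_def)
    then show ?case
      using plus operad_homD[OF f] by (simp add: gen_ideal_def in_gen_ideal.plus)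
  next
    case (scale n x c)
    then have "x \<in> Ops P n" using I.ideal_closed by (simp add: gen_ideal_def)
    then show ?case
      using scale operad_homD[OF f] by (simp add: gen_ideal_def in_gen_ideal.scale)
  next
    case (act n x \<sigma>)
    then have "x \<in> Ops P n" using I.ideal_closed by (simp add: gen_ideal_def)
    then show ?case
      using act operad_homD[OF f] by (simp add: gen_ideal_def in_gen_ideal.act)
  qed
qed

lemma (in operad_ideal) operad_hom_coset: "operad_hom P (quotient_operad P I) (coset P I)"
  unfolding operad_hom_def
  by (simp add: quotient_simps quotient_plus quotient_scale quotient_act quotient_pcomp
      del: One_nat_def)

lemma operad_isomorphic_refl: "operad_isomorphic P P"
  unfolding operad_isomorphic_def operad_iso_def by (rule exI[of _ "\<lambda>n x. x"]) (simp add: bij_betw_def)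

lemma operad_isomorphic_quotient:
  assumes P: "operad_ideal P I" and Q: "operad_ideal Q J"
    and f: "operad_hom P Q f" and g: "operad_hom Q P g"
    and fI: "\<And>n x. x \<in> I n \<Longrightarrow> f n x \<in> J n" and gJ: "\<And>n x. x \<in> J n \<Longrightarrow> g n x \<in> I n"
    and gf: "\<And>n x. x \<in> Ops P n \<Longrightarrow> coset P I n (g n (f n x)) = coset P I n x"
    and fg: "\<And>n y. y \<in> Ops Q n \<Longrightarrow> coset Q J n (f n (g n y)) = coset Q J n y"
  shows "operad_isomorphic (quotient_operad P I) (quotient_operad Q J)"
proof -
  interpret P: operad_ideal P I by (rule P)
  interpret Q: operad_ideal Q J by (rule Q)
  \<comment> \<open>As in \<open>quotient_operad\<close>, the induced maps are unions over
    representatives. \<open>fI\<close> and \<open>gJ\<close> make each union a single coset;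
    \<open>gf\<close> and \<open>fg\<close> make the two maps inverse to each other.\<close>
  define F where "F = (\<lambda>n X. \<Union>x\<in>X. coset Q J n (f n x))"
  define G where "G = (\<lambda>n Y. \<Union>y\<in>Y. coset P I n (g n y))"
  note f' = operad_homD[OF f] and g' = operad_homD[OF g]
  have F: "F n (coset P I n x) = coset Q J n (f n x)" if x: "x \<in> Ops P n" for n x
    unfolding F_def
  proof (rule Q.UN_const[OF P.self_in_coset[OF x]])
    fix z assume "z \<in> coset P I n x"
    then obtain a where "a \<in> I n" "z = plus_op P n x a" by (rule P.in_cosetE)
    then show "coset Q J n (f n z) = coset Q J n (f n x)"
      using x fI f' by (simp add: P.ideal_closed Q.coset_absorb)
  qed
  have G: "G n (coset Q J n x) = coset P I n (g n x)" if x: "x \<in> Ops Q n" for n x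
    unfolding G_def
  proof (rule Q.UN_const[OF Q.self_in_coset[OF x]])
    fix z assume "z \<in> coset Q J n x"
    then obtain a where "a \<in> J n" "z = plus_op Q n x a" by (rule Q.in_cosetE)
    then show "coset P I n (g n z) = coset P I n (g n x)"
      using x gJ g' by (simp add: Q.ideal_closed P.coset_absorb)
  qed
  have bij: "bij_betw (F n) (Ops (quotient_operad P I) n) (Ops (quotient_operad Q J) n)" for n
    by (rule bij_betw_byWitness[where f' = "G n"])
       (auto simp: P.quotient_simps Q.quotient_simps F G f' g' gf fg)
  have "operad_iso (quotient_operad P I) (quotient_operad Q J) F"
    unfolding operad_iso_def
    using bij f' F
    by (auto simp: P.quotient_simps Q.quotient_simps P.quotient_plus Q.quotient_plus
        P.quotient_scale Q.quotient_scale P.quotient_act Q.quotient_act P.quotient_pcomp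
        Q.quotient_pcomp P.plus_closed P.scale_closed P.act_closed P.comp_closed P.unit_closed
        simp del: One_nat_def)
  then show ?thesis unfolding operad_isomorphic_def by blast
qed


section \<open>Homomorphisms between free operads\<close>

lemma app_scale: "app g (scale c p) q = scale c (app g p q)" "app g p (scale c q) = scale c (app g p q)"
proof -
  have "is_linear (app g p)"
    unfolding app_def extend_bilinear_def
    by (rule is_linear_extend_fun is_linear_extend is_linear_id)+
  then show "app g p (scale c q) = scale c (app g p q)" by (simp add: is_linear_def)
qed (simp add: app_def extend_bilinear_def extend_linear_scale)

lemma app_diff_left: "app g (p - p') q = app g p q - app g p' q"
  using app_add(1)[of g "p - p'" p' q] by simp

lemmas app_expand = app_add app_diff app_diff_left app_scale

lemma is_linear_app:
  "is_linear H \<Longrightarrow> is_linear (\<lambda>p. app g (H p) q)"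
  "is_linear H \<Longrightarrow> is_linear (\<lambda>q. app g p (H q))"
  by (simp_all add: is_linear_def app_add app_scale)

text \<open>In contrast to \<open>subst\<close>, leaves receive polynomials. Permutation actions and
  partial compositions of the free operad are both such substitutions, so homomorphism laws reduce
  to compatibility with substitution.\<close>

primrec tree_subst :: "(nat \<Rightarrow> 'g tree \<Rightarrow>\<^sub>0 'k :: comm_ring_1) \<Rightarrow> 'g tree \<Rightarrow> 'g tree \<Rightarrow>\<^sub>0 'k" where
  "tree_subst h (Leaf j) = h j"
| "tree_subst h (Node g s t) = app g (tree_subst h s) (tree_subst h t)"

definition poly_subst ::
  "(nat \<Rightarrow> 'g tree \<Rightarrow>\<^sub>0 'k :: comm_ring_1) \<Rightarrow> ('g tree \<Rightarrow>\<^sub>0 'k) \<Rightarrow> 'g tree \<Rightarrow>\<^sub>0 'k" where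
  "poly_subst h = extend_linear (tree_subst h)"

text \<open>The arguments of a binary operation; every index other than 0 gets the default
  \<open>y\<close>, harmless in arity two. The values are polynomials as well as sets of labels, so
  their type is left open.\<close>

definition pair :: "'v \<Rightarrow> 'v \<Rightarrow> nat \<Rightarrow> 'v" where
  "pair x y j = (if j = 0 then x else y)"

text \<open>The homomorphism of free operads determined by the images \<open>\<phi> g\<close> of the
  generators. It is defined on all labelled trees, because subtrees of a tree in
  \<open>trees n\<close> need not have a label set of the form \<open>{..<m}\<close>.\<close>

primrec tree_hom :: "('g \<Rightarrow> 'h tree \<Rightarrow>\<^sub>0 'k :: comm_ring_1) \<Rightarrow> 'g tree \<Rightarrow> 'h tree \<Rightarrow>\<^sub>0 'k" where
  "tree_hom \<phi> (Leaf j) = var j"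
| "tree_hom \<phi> (Node g s t) = poly_subst (pair (tree_hom \<phi> s) (tree_hom \<phi> t)) (\<phi> g)"

definition free_hom ::
  "('g \<Rightarrow> 'h tree \<Rightarrow>\<^sub>0 'k :: comm_ring_1) \<Rightarrow> ('g tree \<Rightarrow>\<^sub>0 'k) \<Rightarrow> 'h tree \<Rightarrow>\<^sub>0 'k" where
  "free_hom \<phi> = extend_linear (tree_hom \<phi>)"

text \<open>\<open>Ops free_operad n\<close> is the case \<open>A = {..<n}\<close>; other label sets
  are needed for subtrees.\<close>

definition multilinear :: "nat set \<Rightarrow> ('g tree \<Rightarrow>\<^sub>0 'k :: comm_ring_1) set" where
  "multilinear A = {p. \<forall>t \<in> Poly_Mapping.keys p. distinct (leaves t) \<and> set (leaves t) = A}"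

lemma Ops_free_operad: "Ops free_operad n = multilinear {..<n}"
  by (auto simp: free_operad_def multilinear_def trees_def)

lemma poly_subst_monom [simp]: "poly_subst h (monom t) = tree_subst h t"
  by (simp add: poly_subst_def)

lemma free_hom_monom [simp]: "free_hom \<phi> (monom t) = tree_hom \<phi> t"
  by (simp add: free_hom_def)

lemma is_linear_poly_subst: "is_linear H \<Longrightarrow> is_linear (\<lambda>p. poly_subst h (H p))"
  unfolding poly_subst_def by (rule is_linear_extend)

lemma is_linear_free_hom: "is_linear H \<Longrightarrow> is_linear (\<lambda>p. free_hom \<phi> (H p))"
  unfolding free_hom_def by (rule is_linear_extend)

lemmas is_linear_intros = is_linear_app is_linear_poly_subst is_linear_free_hom is_linear_id

lemma linear_simps:
  assumes "is_linear F"
  shows "F (p + q) = F p + F q" "F (scale c p) = scale c (F p)" "F (p - q) = F p - F q" "F 0 = 0"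
proof -
  show *: "F (p + q) = F p + F q" "F (scale c p) = scale c (F p)" for p q
    using assms by (auto simp: is_linear_def)
  show "F (p - q) = F p - F q" using *(1)[of "p - q" q] by simp
  show "F 0 = 0" using *(1)[of 0 0] by simp
qed

lemmas poly_subst_linear = linear_simps[OF is_linear_poly_subst[OF is_linear_id]]
lemmas free_hom_linear = linear_simps[OF is_linear_free_hom[OF is_linear_id]]

lemma poly_subst_var [simp]: "poly_subst h (var j) = h j"
  by (simp add: var_def)

lemma free_hom_var [simp]: "free_hom \<phi> (var j) = var j"
  by (simp add: var_def)

lemma poly_subst_app [simp]: "poly_subst h (app g p q) = app g (poly_subst h p) (poly_subst h q)"
proof (rule linear_eqI[where p = p], goal_cases)
  case (3 s)
  show ?case
    by (rule linear_eqI[where p = q]) (intro is_linear_intros, intro is_linear_intros, simp add: app_monom)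
qed (intro is_linear_intros)+

lemma poly_subst_poly_subst: "poly_subst h (poly_subst k p) = poly_subst (\<lambda>j. poly_subst h (k j)) p"
proof (rule linear_eqI[where p = p], goal_cases)
  case (3 t)
  show ?case by (induction t) auto
qed (intro is_linear_intros)+

lemma tree_subst_cong: "(\<And>j. j \<in> set (leaves t) \<Longrightarrow> h j = k j) \<Longrightarrow> tree_subst h t = tree_subst k t"
  by (induction t) auto

lemma poly_subst_cong:
  assumes "p \<in> multilinear A" "\<And>j. j \<in> A \<Longrightarrow> h j = k j"
  shows "poly_subst h p = poly_subst k p"
proof (rule linear_eqI[where p = p], goal_cases)
  case (3 t)
  then show ?case using assms by (auto simp: multilinear_def intro: tree_subst_cong)
qed (intro is_linear_intros)+

lemma tree_subst_monom: "tree_subst (\<lambda>j. monom (h j)) t = monom (subst h t)"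
  by (induction t) (auto simp: app_monom)

text \<open>The label \<open>i\<close> occurs exactly once, so exactly one factor depends on
  \<open>q\<close>; a missing label would give a constant, a repeated one a map of higher
  degree.\<close>

lemma is_linear_tree_subst:
  assumes "distinct (leaves t)" "i \<in> set (leaves t)"
  shows "is_linear (\<lambda>q. tree_subst (h(i := q)) t)"
  using assms
proof (induction t)
  case (Leaf j)
  then show ?case by (simp add: is_linear_id)
next
  case (Node g s t)
  have *: "tree_subst (h(i := q)) u = tree_subst h u" if "i \<notin> set (leaves u)" for u q
    using that by (intro tree_subst_cong) auto
  show ?case
  proof (cases "i \<in> set (leaves s)")
    case True
    then have "i \<notin> set (leaves t)" using Node.prems by auto
    then show ?thesis using True Node by (simp add: * is_linear_app del: fun_upd_apply)
  next
    case False
    then show ?thesis using Node by (simp add: * is_linear_app del: fun_upd_apply)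
  qed
qed

lemma is_linear_poly_subst_arg:
  assumes "p \<in> multilinear A" "i \<in> A" and H: "is_linear H"
  shows "is_linear (\<lambda>q. poly_subst (h(i := H q)) p)"
proof -
  have "is_linear (\<lambda>q. tree_subst (h(i := H q)) t)" if "t \<in> Poly_Mapping.keys p" for t
    using is_linear_tree_subst[of t i h] that assms by (auto simp: multilinear_def is_linear_def)
  then show ?thesis
    unfolding poly_subst_def is_linear_def extend_linear_def
    by (auto simp: scale_add sum.distrib scale_sum mult.commute intro!: sum.cong)
qed

lemma is_linear_poly_subst_pair:
  assumes p: "p \<in> multilinear {..<2}" and H: "is_linear H"
  shows "is_linear (\<lambda>q. poly_subst (pair (H q) r) p)" "is_linear (\<lambda>q. poly_subst (pair r (H q)) p)"
proof -
  \<comment> \<open>The two updates have different defaults, but both agree with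
    \<open>pair x y\<close> on the inputs 0 and 1, the only ones in \<open>p\<close>.\<close>
  have 0: "poly_subst (pair x y) p = poly_subst ((\<lambda>_. y)(0 := x)) p"
    and 1: "poly_subst (pair x y) p = poly_subst ((\<lambda>_. x)(1 := y)) p" for x y
    by (rule poly_subst_cong[OF p]; force simp: pair_def)+
  show "is_linear (\<lambda>q. poly_subst (pair (H q) r) p)"
    unfolding 0 by (rule is_linear_poly_subst_arg[OF p _ H]) simp
  show "is_linear (\<lambda>q. poly_subst (pair r (H q)) p)"
    unfolding 1 by (rule is_linear_poly_subst_arg[OF p _ H]) simp
qed

lemma app_multilinear:
  assumes p: "p \<in> multilinear A" and q: "q \<in> multilinear B" and "A \<inter> B = {}"
  shows "app g p q \<in> multilinear (A \<union> B)"
proof -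
  have "Poly_Mapping.keys (app g p q) \<subseteq> {t. distinct (leaves t) \<and> set (leaves t) = A \<union> B}"
    unfolding app_def extend_bilinear_def
    by (intro keys_extend_linear) (use assms in \<open>auto simp: multilinear_def\<close>)
  then show ?thesis by (auto simp: multilinear_def)
qed

lemma tree_subst_multilinear:
  assumes "distinct (leaves t)" "\<And>j. j \<in> set (leaves t) \<Longrightarrow> h j \<in> multilinear (A j)"
    and "disjoint_family_on A (set (leaves t))"
  shows "tree_subst h t \<in> multilinear (\<Union>j\<in>set (leaves t). A j)"
  using assms
proof (induction t)
  case (Node g s t)
  have "A i \<inter> A j = {}" if "i \<in> set (leaves s)" "j \<in> set (leaves t)" for i j
  proof -
    have "i \<noteq> j" using that Node.prems(1) by auto
    then show ?thesis using that Node.prems(3) by (simp add: disjoint_family_on_def)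
  qed
  then have "(\<Union>j\<in>set (leaves s). A j) \<inter> (\<Union>j\<in>set (leaves t). A j) = {}"
    by blast
  moreover have "disjoint_family_on A (set (leaves s))" "disjoint_family_on A (set (leaves t))"
    using Node.prems by (auto simp: disjoint_family_on_def)
  ultimately show ?case using Node by (simp add: UN_Un app_multilinear)
qed simp

lemma poly_subst_multilinear:
  assumes p: "p \<in> multilinear B" and h: "\<And>j. j \<in> B \<Longrightarrow> h j \<in> multilinear (A j)"
    and A: "disjoint_family_on A B"
  shows "poly_subst h p \<in> multilinear (\<Union>j\<in>B. A j)"
proof -
  have "Poly_Mapping.keys (poly_subst h p)
      \<subseteq> {t. distinct (leaves t) \<and> set (leaves t) = (\<Union>j\<in>B. A j)}"
    unfolding poly_subst_def
  proof (rule keys_extend_linear)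
    fix t assume "t \<in> Poly_Mapping.keys p"
    then have "distinct (leaves t)" "set (leaves t) = B" using p by (auto simp: multilinear_def)
    then have "tree_subst h t \<in> multilinear (\<Union>j\<in>B. A j)"
      using tree_subst_multilinear[of t h A] h A by simp
    then show "Poly_Mapping.keys (tree_subst h t)
        \<subseteq> {t. distinct (leaves t) \<and> set (leaves t) = (\<Union>j\<in>B. A j)}"
      by (auto simp: multilinear_def)
  qed
  then show ?thesis by (auto simp: multilinear_def)
qed

section \<open>The structure of the free operad expressed by substitution\<close>

lemma act_free_operad: "act free_operad n \<sigma> p = poly_subst (\<lambda>j. var (\<sigma> j)) p"
  by (simp add: free_operad_def relabel_def poly_subst_def var_def flip: tree_subst_monom)

text \<open>The right side is linear in \<open>y\<close> because the input \<open>i\<close> occurs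
  exactly once in each monomial of \<open>x\<close>, by membership in the carrier. On trees both
  sides are the definition of \<open>graft\<close>.\<close>

lemma pcomp_free_operad:
  assumes x: "x \<in> Ops free_operad m" and i: "i < m"
  shows "pcomp free_operad m n i x y =
    poly_subst (\<lambda>j. if j < i then var j else if j = i then poly_subst (\<lambda>k. var (i + k)) y
      else var (j + n - 1)) x"
proof -
  have *: "(\<lambda>j. if j < i then var j else if j = i then q else var (j + n - 1))
      = (\<lambda>j. if j < i then var j else var (j + n - 1))(i := q)" for q :: "'a tree \<Rightarrow>\<^sub>0 'b"
    by auto
  have x': "x \<in> multilinear {..<m}" using x by (simp add: Ops_free_operad)
  have "extend_bilinear (\<lambda>s t. monom (graft n i s t)) x y =
    poly_subst (\<lambda>j. if j < i then var j else if j = i then poly_subst (\<lambda>k. var (i + k)) y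
      else var (j + n - 1)) x"
    unfolding extend_bilinear_def
  proof (rule linear_eqI[where p = y], goal_cases)
    case 1
    show ?case by (intro is_linear_extend_fun is_linear_extend is_linear_id)
  next
    case 2
    show ?case
      unfolding * using x' i by (intro is_linear_poly_subst_arg[of _ "{..<m}"] is_linear_intros) simp_all
  next
    case (3 t)
    show ?case
    proof (rule linear_eqI[where p = x], goal_cases)
      case (3 s)
      have *: "(\<lambda>j. if j < i then var j else if j = i then tree_subst (\<lambda>k. var (i + k)) t
            else var (j + n - 1))
          = (\<lambda>j. monom (if j < i then Leaf j else if j = i then relabel (\<lambda>k. i + k) t
              else Leaf (j + n - 1)))"
        by (auto simp: var_def tree_subst_monom relabel_def)
      show ?case
        by (simp only: poly_subst_monom extend_linear_monom graft_def * tree_subst_monom)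
    qed (intro is_linear_extend is_linear_intros)+
  qed
  then show ?thesis by (simp add: free_operad_def)
qed

lemma tree_hom_multilinear:
  assumes \<phi>: "\<And>g. \<phi> g \<in> Ops free_operad 2" and "distinct (leaves t)"
  shows "tree_hom \<phi> t \<in> multilinear (set (leaves t))"
  using assms(2)
proof (induction t)
  case (Leaf j)
  then show ?case by (simp add: var_def multilinear_def)
next
  case (Node g s t)
  have "poly_subst (pair (tree_hom \<phi> s) (tree_hom \<phi> t)) (\<phi> g)
      \<in> multilinear (\<Union>j\<in>{..<2}. pair (set (leaves s)) (set (leaves t)) j)"
    using Node \<phi>[of g]
    by (intro poly_subst_multilinear) (auto simp: Ops_free_operad pair_def disjoint_family_on_def)
  also have "(\<Union>j\<in>{..<2::nat}. pair (set (leaves s)) (set (leaves t)) j) = set (leaves (Node g s t))"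
    by (force simp: pair_def)
  finally show ?case by simp
qed

lemma free_hom_closed:
  assumes \<phi>: "\<And>g. \<phi> g \<in> Ops free_operad 2" and p: "p \<in> Ops free_operad n"
  shows "free_hom \<phi> p \<in> Ops free_operad n"
proof -
  have "Poly_Mapping.keys (free_hom \<phi> p) \<subseteq> trees n"
    unfolding free_hom_def
  proof (rule keys_extend_linear)
    fix t assume "t \<in> Poly_Mapping.keys p"
    then have "distinct (leaves t)" "set (leaves t) = {..<n}"
      using p by (auto simp: free_operad_def trees_def)
    then show "Poly_Mapping.keys (tree_hom \<phi> t) \<subseteq> trees n"
      using tree_hom_multilinear[of \<phi> t] \<phi> by (auto simp: multilinear_def trees_def)
  qed
  then show ?thesis by (simp add: free_operad_def)
qed

text \<open>For \<open>\<phi> g\<close> of arity two the right side is bilinear in \<open>p\<close>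
  and \<open>q\<close>, which reduces the claim to trees, where it is the recursion of
  \<open>tree_hom\<close>.\<close>

lemma free_hom_app:
  assumes \<phi>: "\<And>g. \<phi> g \<in> Ops free_operad 2"
  shows "free_hom \<phi> (app g p q) = poly_subst (pair (free_hom \<phi> p) (free_hom \<phi> q)) (\<phi> g)"
proof -
  have \<phi>': "\<phi> g \<in> multilinear {..<2}" for g using \<phi> by (simp add: Ops_free_operad)
  show ?thesis
  proof (rule linear_eqI[where p = p], goal_cases)
    case (3 s)
    show ?case
      by (rule linear_eqI[where p = q];
          (intro is_linear_intros is_linear_poly_subst_pair \<phi>')?) (simp add: app_monom)
  qed (intro is_linear_intros is_linear_poly_subst_pair \<phi>')+
qed

text \<open>This single identity yields compatibility with both permutations and partial
  compositions. At a node it comes down to associativity of substitution.\<close>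

lemma free_hom_poly_subst:
  assumes \<phi>: "\<And>g. \<phi> g \<in> Ops free_operad 2"
  shows "free_hom \<phi> (poly_subst h p) = poly_subst (\<lambda>j. free_hom \<phi> (h j)) (free_hom \<phi> p)"
proof (rule linear_eqI[where p = p], goal_cases)
  case (3 t)
  show ?case
  proof (induction t)
    case (Node g s t)
    have "(\<lambda>j. poly_subst (\<lambda>j. free_hom \<phi> (h j)) (pair (tree_hom \<phi> s) (tree_hom \<phi> t) j))
       = pair (poly_subst (\<lambda>j. free_hom \<phi> (h j)) (tree_hom \<phi> s))
              (poly_subst (\<lambda>j. free_hom \<phi> (h j)) (tree_hom \<phi> t))"
      by (auto simp: pair_def)
    then show ?case using Node by (simp add: free_hom_app[OF \<phi>] poly_subst_poly_subst)
  qed simp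
qed (intro is_linear_intros)+

lemma operad_hom_free_hom:
  assumes \<phi>: "\<And>g. \<phi> g \<in> Ops free_operad 2"
  shows "operad_hom free_operad free_operad (\<lambda>n. free_hom \<phi>)"
proof -
  have "free_hom \<phi> (pcomp free_operad m n i x y)
      = pcomp free_operad m n i (free_hom \<phi> x) (free_hom \<phi> y)"
    if "i < m" "x \<in> Ops free_operad m" for m n i x y
    using that
    by (simp add: pcomp_free_operad free_hom_closed[OF \<phi>] free_hom_poly_subst[OF \<phi>]
        if_distrib[of "free_hom \<phi>"] cong: if_cong)
  moreover have "free_hom \<phi> (act free_operad n \<sigma> x) = act free_operad n \<sigma> (free_hom \<phi> x)" for n \<sigma> x
    by (simp add: act_free_operad free_hom_poly_subst[OF \<phi>])
  moreover have "free_hom \<phi> (unit_op free_operad) = unit_op free_operad"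
    by (simp add: free_operad_def var_def)
  moreover have "free_hom \<phi> (plus_op free_operad n x y)
      = plus_op free_operad n (free_hom \<phi> x) (free_hom \<phi> y)"
    "free_hom \<phi> (scale_op free_operad n c x) = scale_op free_operad n c (free_hom \<phi> x)" for n x y c
    by (simp_all add: free_operad_def free_hom_linear)
  ultimately show ?thesis
    unfolding operad_hom_def by (simp add: free_hom_closed[OF \<phi>])
qed

section \<open>Homomorphisms out of the free operad are determined by generators\<close>

text \<open>Structural induction leaves the operad, since subtrees lose the standard labelling. The
  remedy is to build up \<open>P\<close> on standard representatives and recover each tree by an
  injective relabelling. In \<open>node\<close>, the left tree fills input 0 and occupies the labels
  below \<open>a\<close>, which moves the second input of the generator to \<open>a\<close>.\<close>

lemma tree_normal_form:
  assumes "distinct (leaves t)" and leaf: "P 1 (Leaf 0)"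
    and node: "\<And>a b g s t. s \<in> trees a \<Longrightarrow> t \<in> trees b \<Longrightarrow> P a s \<Longrightarrow> P b t \<Longrightarrow>
      P (a + b) (graft b a (graft a 0 (Node g (Leaf 0) (Leaf 1)) s) t)"
  shows "\<exists>n s \<rho>. s \<in> trees n \<and> P n s \<and> t = relabel \<rho> s \<and> inj_on \<rho> {..<n}"
  using assms(1)
proof (induction t)
  case (Leaf j)
  show ?case
    by (rule exI[of _ 1], rule exI[of _ "Leaf 0"], rule exI[of _ "\<lambda>_. j"])
       (use leaf in \<open>auto simp: trees_def relabel_def inj_on_def\<close>)
next
  case (Node g s t)
  then obtain a s' \<alpha> b t' \<beta> where s: "s' \<in> trees a" "P a s'" "s = relabel \<alpha> s'" "inj_on \<alpha> {..<a}"
    and t: "t' \<in> trees b" "P b t'" "t = relabel \<beta> t'" "inj_on \<beta> {..<b}"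
    by auto
  \<comment> \<open>The labels of \<open>t'\<close> are shifted by \<open>a\<close> inside the
    composite, so \<open>\<rho>\<close> undoes the shift before applying
    \<open>\<beta>\<close>.\<close>
  define \<rho> where "\<rho> k = (if k < a then \<alpha> k else \<beta> (k - a))" for k
  have S: "set (leaves s') = {..<a}" and T: "set (leaves t') = {..<b}"
    using s t by (auto simp: trees_def)
  let ?u = "graft b a (graft a 0 (Node g (Leaf 0) (Leaf 1)) s') t'"
  have rs: "relabel ((+) 0) s' = s'" unfolding relabel_def by (rule subst_Leaf) simp
  have gs: "graft b a s' t' = s'" unfolding graft_def by (rule subst_Leaf) (simp add: S)
  have u: "?u = Node g s' (relabel (\<lambda>k. a + k) t')"
    using rs gs by (simp add: graft_def)
  have "relabel \<rho> s' = s" "relabel \<rho> (relabel (\<lambda>k. a + k) t') = t"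
    unfolding s t relabel_def subst_subst by (rule subst_cong; simp add: \<rho>_def S T)+
  then have eq: "Node g s t = relabel \<rho> ?u" unfolding u by (simp add: relabel_def)
  have "Node g (Leaf 0) (Leaf 1) \<in> trees 2" by (auto simp: trees_def)
  from graft_in_trees[OF graft_in_trees[OF this s(1), of 0] t(1), of a]
  have "?u \<in> trees (a + b)" by simp
  moreover from this have "inj_on \<rho> {..<a + b}"
    using Node.prems unfolding eq by (simp add: distinct_map trees_def)
  ultimately show ?case using eq node[OF s(1) t(1) s(2) t(2)] by blast
qed

lemma trees_induct [consumes 1, case_names leaf node relabel]:
  assumes t: "t \<in> trees n" and leaf: "P 1 (Leaf 0)"
    and node: "\<And>a b g s t. s \<in> trees a \<Longrightarrow> t \<in> trees b \<Longrightarrow> P a s \<Longrightarrow> P b t \<Longrightarrow>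
      P (a + b) (graft b a (graft a 0 (Node g (Leaf 0) (Leaf 1)) s) t)"
    and relabel: "\<And>n \<sigma> t. \<sigma> permutes {..<n} \<Longrightarrow> t \<in> trees n \<Longrightarrow> P n t \<Longrightarrow> P n (relabel \<sigma> t)"
  shows "P n t"
proof -
  obtain m s \<rho> where s: "s \<in> trees m" "P m s" "t = relabel \<rho> s" "inj_on \<rho> {..<m}"
    using tree_normal_form[of t P] t leaf node by (auto simp: trees_def)
  have im: "\<rho> ` {..<m} = {..<n}" using s(1,3) t by (auto simp: trees_def)
  then have mn: "m = n" using card_image[OF s(4)] by simp
  \<comment> \<open>\<open>\<rho>\<close> is controlled only below \<open>n\<close>; elsewhere it is
    replaced by the identity to obtain a permutation.\<close>
  define \<sigma> where "\<sigma> k = (if k < n then \<rho> k else k)" for k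
  have "bij_betw \<sigma> {..<n} {..<n}"
    using im s(4) mn by (auto simp: bij_betw_def inj_on_def \<sigma>_def)
  then have "\<sigma> permutes {..<n}" by (rule bij_imp_permutes) (simp add: \<sigma>_def)
  moreover have "t = relabel \<sigma> s"
    unfolding s(3) relabel_def
    by (rule subst_cong) (use s(1) in \<open>auto simp: \<sigma>_def mn trees_def\<close>)
  ultimately show ?thesis using relabel s mn by simp
qed

text \<open>The unit, the generators, compositions and permutations produce all trees
  (\<open>trees_induct\<close>), and linearity does the rest.\<close>

lemma free_operad_hom_eqI:
  fixes F G :: "nat \<Rightarrow> ('g tree \<Rightarrow>\<^sub>0 'k :: comm_ring_1) \<Rightarrow> 'a"
  assumes Q: "operad Q" and F: "operad_hom free_operad Q F" and G: "operad_hom free_operad Q G"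
    and gens: "\<And>g. F 2 (app g (var 0) (var 1)) = G 2 (app g (var 0) (var 1))"
    and x: "x \<in> Ops free_operad n"
  shows "F n x = G n x"
proof -
  note f = operad_homD[OF F] and g = operad_homD[OF G]
  have mon: "(monom t :: _ \<Rightarrow>\<^sub>0 'k) \<in> Ops free_operad n" if "t \<in> trees n" for t :: "'g tree" and n
    using that by (rule free_operad_closed)
  have pc: "(monom (graft n i s t) :: _ \<Rightarrow>\<^sub>0 'k) = pcomp free_operad m n i (monom s) (monom t)"
    for m n i and s t :: "'g tree"
    by (simp add: free_operad_def extend_bilinear_def)
  have tree: "F n (monom t) = G n (monom t)" if "t \<in> trees n" for n t
    using that
  proof (induction rule: trees_induct)
    case leaf
    show ?case using f(5) g(5) by (simp add: free_operad_def)
  next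
    case (node a b h s t)
    have N: "Node h (Leaf 0) (Leaf 1) \<in> trees 2" by (auto simp: trees_def)
    have ab: "2 + a - 1 = a + 1" "a + 1 + b - 1 = a + b" by auto
    have T: "graft a 0 (Node h (Leaf 0) (Leaf 1)) s \<in> trees (a + 1)"
      using graft_in_trees[OF N node(1), of 0] by (simp add: ab)
    have gen: "F 2 (monom (Node h (Leaf 0) (Leaf 1))) = G 2 (monom (Node h (Leaf 0) (Leaf 1)))"
      using gens[of h] by (simp add: var_def app_monom)
    have 1: "F (a + 1) (monom (graft a 0 (Node h (Leaf 0) (Leaf 1)) s))
        = G (a + 1) (monom (graft a 0 (Node h (Leaf 0) (Leaf 1)) s))"
      using f(6)[of 0 2 "monom (Node h (Leaf 0) (Leaf 1))" "monom s" a]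
        g(6)[of 0 2 "monom (Node h (Leaf 0) (Leaf 1))" "monom s" a] mon N node gen
      unfolding ab pc[of a 0 _ s 2] by simp
    show ?case
      using f(6)[of a "a + 1" _ "monom t" b, OF _ mon[OF T]]
        g(6)[of a "a + 1" _ "monom t" b, OF _ mon[OF T]] mon node 1
      unfolding ab pc[of b a _ t "a + 1"] by simp
  next
    case (relabel n \<sigma> t)
    have "(monom (relabel \<sigma> t) :: _ \<Rightarrow>\<^sub>0 'k) = act free_operad n \<sigma> (monom t)" by (simp add: free_operad_def)
    then show ?case using relabel mon f(4) g(4) by simp
  qed
  \<comment> \<open>The linear structure of \<open>Q\<close> lives only on its carriers, out of
    reach of \<open>linear_eqI\<close>. Monomials are split off one at a time, by induction on a
    finite set containing the support.\<close>
  have "F n x = G n x" if "finite K" "K \<subseteq> trees n" "Poly_Mapping.keys x \<subseteq> K" for K x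
    using that
  proof (induction K arbitrary: x)
    case empty
    then have "x = zero_op free_operad n" by (simp add: free_operad_def)
    then show ?case
      using operad_hom_zero[OF operad_free Q F] operad_hom_zero[OF operad_free Q G] by simp
  next
    case (insert t K)
    define c where "c = Poly_Mapping.lookup x t"
    define y where "y = x - scale c (monom t)"
    have K: "Poly_Mapping.keys y \<subseteq> K"
    proof
      fix u assume "u \<in> Poly_Mapping.keys y"
      then have "u \<noteq> t" "u \<in> Poly_Mapping.keys x"
        by (auto simp: y_def c_def in_keys_iff lookup_minus monom_def lookup_single when_def
            split: if_splits)
      then show "u \<in> K" using insert.prems(2) by blast
    qed
    have t: "monom t \<in> Ops free_operad n" and y: "y \<in> Ops free_operad n"
      using insert.prems K mon by (auto simp: free_operad_def)
    have x: "x = plus_op free_operad n (scale_op free_operad n c (monom t)) y"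
      by (simp add: y_def free_operad_def)
    have c: "scale_op free_operad n c (monom t) \<in> Ops free_operad n"
      using operad.scale_closed[OF operad_free t] .
    have "F n y = G n y" "F n (monom t) = G n (monom t)"
      using insert K tree by auto
    then show ?case unfolding x by (simp add: f(2,3) g(2,3) c y t)
  qed
  from this[OF finite_keys _ order_refl] show ?thesis using x by (simp add: free_operad_def)
qed

lemma poly_subst_ident [simp]: "poly_subst var p = p"
  by (rule linear_eqI[where p = p]; (intro is_linear_intros)?)
     (simp add: var_def[abs_def] tree_subst_monom subst_Leaf)

lemma poly_subst_pair_ident:
  assumes "p \<in> Ops free_operad 2"
  shows "poly_subst (pair (var 0) (var 1)) p = p"
proof -
  have "poly_subst (pair (var 0) (var 1)) p = poly_subst var p"
    using assms by (intro poly_subst_cong) (auto simp: Ops_free_operad pair_def less_2_cases_iff)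
  then show ?thesis by simp
qed

text \<open>Both sides are homomorphisms from the free operad to the quotient, so it is enough that
  they agree on generators, which is \<open>\<psi>\<phi>\<close>.\<close>

lemma coset_free_hom_free_hom:
  fixes \<phi> :: "'g \<Rightarrow> 'h tree \<Rightarrow>\<^sub>0 'k :: comm_ring_1" and \<psi> :: "'h \<Rightarrow> 'g tree \<Rightarrow>\<^sub>0 'k"
  assumes R: "\<And>n. R n \<subseteq> Ops free_operad n"
    and \<phi>: "\<And>g. \<phi> g \<in> Ops free_operad 2" and \<psi>: "\<And>h. \<psi> h \<in> Ops free_operad 2"
    and \<psi>\<phi>: "\<And>g. free_hom \<psi> (\<phi> g) - app g (var 0) (var 1) \<in> gen_ideal free_operad R 2"
    and x: "x \<in> Ops free_operad n"
  shows "coset free_operad (gen_ideal free_operad R) n (free_hom \<psi> (free_hom \<phi> x))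
    = coset free_operad (gen_ideal free_operad R) n x"
proof -
  interpret I: operad_ideal free_operad "gen_ideal free_operad R"
    by (rule operad.operad_ideal_gen_ideal[OF operad_free R])
  show ?thesis
  proof (rule free_operad_hom_eqI[OF I.operad_quotient _ I.operad_hom_coset _ x])
    show "operad_hom free_operad (quotient_operad free_operad (gen_ideal free_operad R))
        (\<lambda>n x. coset free_operad (gen_ideal free_operad R) n (free_hom \<psi> (free_hom \<phi> x)))"
      by (rule operad_hom_comp[OF operad_hom_comp[OF operad_hom_free_hom[OF \<phi>]
        operad_hom_free_hom[OF \<psi>]] I.operad_hom_coset])
    fix g
    have e: "free_hom \<phi> (app g (var 0) (var 1)) = \<phi> g"
      unfolding free_hom_app[OF \<phi>] free_hom_var by (rule poly_subst_pair_ident[OF \<phi>])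
    have a: "app g (var 0) (var 1) \<in> Ops free_operad 2"
      by (auto simp: app_monom var_def free_operad_def trees_def)
    show "coset free_operad (gen_ideal free_operad R) 2 (free_hom \<psi> (free_hom \<phi> (app g (var 0) (var 1))))
        = coset free_operad (gen_ideal free_operad R) 2 (app g (var 0) (var 1))"
      using I.coset_absorb[OF a \<psi>\<phi>[of g]] unfolding e by (simp add: free_operad_def)
  qed
qed

lemma presented_operad_isomorphicI:
  fixes \<phi> :: "'g \<Rightarrow> 'h tree \<Rightarrow>\<^sub>0 'k :: comm_ring_1" and \<psi> :: "'h \<Rightarrow> 'g tree \<Rightarrow>\<^sub>0 'k"
  assumes R: "\<And>n. R n \<subseteq> Ops free_operad n" and S: "\<And>n. S n \<subseteq> Ops free_operad n"
    and \<phi>: "\<And>g. \<phi> g \<in> Ops free_operad 2" and \<psi>: "\<And>h. \<psi> h \<in> Ops free_operad 2"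
    and \<phi>R: "\<And>n r. r \<in> R n \<Longrightarrow> free_hom \<phi> r \<in> gen_ideal free_operad S n"
    and \<psi>S: "\<And>n r. r \<in> S n \<Longrightarrow> free_hom \<psi> r \<in> gen_ideal free_operad R n"
    and \<psi>\<phi>: "\<And>g. free_hom \<psi> (\<phi> g) - app g (var 0) (var 1) \<in> gen_ideal free_operad R 2"
    and \<phi>\<psi>: "\<And>h. free_hom \<phi> (\<psi> h) - app h (var 0) (var 1) \<in> gen_ideal free_operad S 2"
  shows "operad_isomorphic (presented_operad R) (presented_operad S)"
  unfolding presented_operad_def
proof (rule operad_isomorphic_quotient)
  show "operad_ideal free_operad (gen_ideal free_operad R)"
    "operad_ideal free_operad (gen_ideal free_operad S)"
    by (rule operad.operad_ideal_gen_ideal[OF operad_free R]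
        operad.operad_ideal_gen_ideal[OF operad_free S])+
  show hom: "operad_hom free_operad free_operad (\<lambda>n. free_hom \<phi>)"
    "operad_hom free_operad free_operad (\<lambda>n. free_hom \<psi>)"
    by (rule operad_hom_free_hom[OF \<phi>] operad_hom_free_hom[OF \<psi>])+
  show "free_hom \<phi> x \<in> gen_ideal free_operad S n" if "x \<in> gen_ideal free_operad R n" for n x
    by (rule operad_hom_gen_ideal[OF operad_free operad_free hom(1) R \<phi>R that])
  show "free_hom \<psi> x \<in> gen_ideal free_operad R n" if "x \<in> gen_ideal free_operad S n" for n x
    by (rule operad_hom_gen_ideal[OF operad_free operad_free hom(2) S \<psi>S that])
qed (rule coset_free_hom_free_hom[OF R \<phi> \<psi> \<psi>\<phi>] coset_free_hom_free_hom[OF S \<psi> \<phi> \<phi>\<psi>]; assumption)+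

section \<open>Membership in generated ideals\<close>

lemma free_operad_simps:
  "zero_op free_operad n = 0" "plus_op free_operad n p q = p + q" "scale_op free_operad n c p = scale c p"
  by (simp_all add: free_operad_def)

text \<open>
  Testing membership with functionals turns a computation modulo the ideal into the derivation of
  an equation between scalars, which Groebner bases can do.
\<close>

lemma gen_ideal_functionalI:
  fixes x :: "'g tree \<Rightarrow>\<^sub>0 'k :: field"
  assumes "\<And>f. Vector_Spaces.linear scale (*) f \<Longrightarrow> \<forall>y\<in>gen_ideal free_operad R n. f y = 0 \<Longrightarrow> f x = 0"
  shows "x \<in> gen_ideal free_operad R n"
proof (rule ccontr)
  assume x: "x \<notin> gen_ideal free_operad R n"
  interpret vector_space_pair "scale :: 'k \<Rightarrow> ('g tree \<Rightarrow>\<^sub>0 'k) \<Rightarrow> _" "(*) :: 'k \<Rightarrow> 'k \<Rightarrow> 'k"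
    by unfold_locales (auto simp: scale_add algebra_simps)
  define V where "V = gen_ideal (free_operad :: ('k, 'g tree \<Rightarrow>\<^sub>0 'k) operad) R n"
  have "0 \<in> V" "\<And>p q. p \<in> V \<Longrightarrow> q \<in> V \<Longrightarrow> p + q \<in> V" "\<And>c p. p \<in> V \<Longrightarrow> scale c p \<in> V"
    using in_gen_ideal.zero[of free_operad R n] in_gen_ideal.plus[of free_operad R n]
      in_gen_ideal.scale[of free_operad R n]
    by (simp_all add: V_def gen_ideal_def free_operad_simps)
  then have V: "vs1.subspace V" unfolding vs1.subspace_def by blast
  obtain B where B: "B \<subseteq> V" "vs1.independent B" "V \<subseteq> vs1.span B" "card B = vs1.dim V"
    by (rule vs1.basis_exists)
  have sp: "vs1.span B = V"
    by (rule subset_antisym[OF vs1.span_minimal[OF B(1) V] B(3)])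
  have "vs1.independent (insert x B)"
    by (rule vs1.independent_insertI[OF _ B(2)]) (use x in \<open>simp add: sp V_def\<close>)
  from linear_independent_extend[OF this, of "\<lambda>y. if y = x then 1 else 0"]
  obtain f where f: "Vector_Spaces.linear scale (*) f"
    and fB: "\<forall>y\<in>insert x B. f y = (if y = x then 1 else 0)"
    by (elim exE conjE)
  interpret f: Vector_Spaces.linear scale "(*)" f by (rule f)
  have "vs1.subspace {y. f y = 0}"
    unfolding vs1.subspace_def by (simp add: f.zero f.add f.scale)
  moreover have "B \<subseteq> {y. f y = 0}"
  proof
    fix y assume "y \<in> B"
    moreover from this have "y \<noteq> x" using B(1) x unfolding V_def by blast
    ultimately show "y \<in> {y. f y = 0}" using fB by simp
  qed
  ultimately have "vs1.span B \<subseteq> {y. f y = 0}" by (rule vs1.span_minimal[rotated])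
  then have "f x = 0" using assms[OF f] unfolding sp V_def by blast
  then show False using fB by simp
qed

section \<open>Consequences of relations in arity three\<close>

lemma vars_permutation:
  assumes uvw: "distinct [u, v, w]" "u < 3" "v < 3" "w < (3::nat)"
  obtains \<sigma> where "\<sigma> permutes {..<3}" "\<sigma> 0 = u" "\<sigma> 1 = v" "\<sigma> 2 = w"
proof
  let ?\<sigma> = "id(0 := u, 1 := v, 2 := w)"
  show "?\<sigma> permutes {..<3}"
  proof (rule bij_imp_permutes)
    have 3: "{..<3} = {0, 1, 2::nat}" by auto
    have "inj_on ?\<sigma> {..<3}" using uvw unfolding 3 by (simp add: inj_on_def)
    moreover have "?\<sigma> ` {..<3} \<subseteq> {..<3}" using uvw by auto
    ultimately show "bij_betw ?\<sigma> {..<3} {..<3}" using endo_inj_surj[of "{..<3}" ?\<sigma>] unfolding bij_betw_def by blast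
  qed auto
qed auto

text \<open>An element \<open>r\<close> of the ideal in arity two meets a generator \<open>g\<close>
  in four ways: \<open>g\<close> inserted in either input of \<open>r\<close>, or \<open>r\<close>
  in either input of \<open>g\<close>. A permutation then distributes the variables.\<close>

lemma
  fixes r :: "'g tree \<Rightarrow>\<^sub>0 'k :: comm_ring_1"
  assumes R: "\<And>n. R n \<subseteq> Ops free_operad n" and r: "r \<in> gen_ideal free_operad R 2"
    and uvw: "distinct [u, v, w]" "u < 3" "v < 3" "w < 3"
  shows gen_ideal_subst_right:
      "poly_subst (pair (var u) (app g (var v) (var w))) r \<in> gen_ideal free_operad R 3" (is ?right)
    and gen_ideal_subst_left:
      "poly_subst (pair (app g (var u) (var v)) (var w)) r \<in> gen_ideal free_operad R 3" (is ?left)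
    and gen_ideal_app_right:
      "app g (var u) (poly_subst (pair (var v) (var w)) r) \<in> gen_ideal free_operad R 3" (is ?app_right)
    and gen_ideal_app_left:
      "app g (poly_subst (pair (var u) (var v)) r) (var w) \<in> gen_ideal free_operad R 3" (is ?app_left)
proof -
  interpret I: operad_ideal free_operad "gen_ideal free_operad R"
    by (rule operad.operad_ideal_gen_ideal[OF operad_free R])
  obtain \<sigma> where \<sigma>: "\<sigma> permutes {..<3}" and s: "\<sigma> 0 = u" "\<sigma> 1 = v" "\<sigma> 2 = w"
    using vars_permutation[OF uvw] by metis
  note s = s s(2)[unfolded One_nat_def] s(3)[unfolded numeral_2_eq_2]
  let ?g = "app g (var 0) (var 1) :: 'g tree \<Rightarrow>\<^sub>0 'k"
  have g: "?g \<in> Ops free_operad 2"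
    by (auto simp: app_monom var_def free_operad_def trees_def)
  have r': "r \<in> Ops free_operad 2" by (rule I.ideal_closed[OF r])
  have eq: "poly_subst h r = poly_subst (pair x y) r" if "h 0 = x" "h 1 = y" for h x y
    by (rule poly_subst_cong[of _ "{..<2}"])
       (use r' that in \<open>auto simp: Ops_free_operad pair_def less_2_cases_iff\<close>)
  have 2: "(0::nat) < 2" "(1::nat) < 2" by simp_all
  note c = I.ideal_act[OF I.ideal_comp_left[OF r g], of _ \<sigma>]
    I.ideal_act[OF I.ideal_comp_right[OF g r], of _ \<sigma>]
  have n: "2 + 2 - 1 = (3::nat)" by simp
  note c = c[unfolded n, OF _ \<sigma>]
  have "act free_operad 3 \<sigma> (pcomp free_operad 2 2 1 r ?g) = poly_subst (pair (var u) (app g (var v) (var w))) r"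
    unfolding act_free_operad pcomp_free_operad[OF r' 2(2)] poly_subst_poly_subst
    by (rule eq) (simp_all add: s)
  then show ?right using c(1)[OF 2(2)] by simp
  have "act free_operad 3 \<sigma> (pcomp free_operad 2 2 0 r ?g) = poly_subst (pair (app g (var u) (var v)) (var w)) r"
    unfolding act_free_operad pcomp_free_operad[OF r' 2(1)] poly_subst_poly_subst
    by (rule eq) (simp_all add: s)
  then show ?left using c(1)[OF 2(1)] by simp
  have "poly_subst (\<lambda>j. var (\<sigma> (1 + j))) r = poly_subst (pair (var v) (var w)) r"
    by (rule eq) (simp_all add: s)
  then have "act free_operad 3 \<sigma> (pcomp free_operad 2 2 1 ?g r) = app g (var u) (poly_subst (pair (var v) (var w)) r)"
    unfolding act_free_operad pcomp_free_operad[OF g 2(2)] poly_subst_poly_subst poly_subst_app poly_subst_var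
    by (simp add: s poly_subst_poly_subst)
  then show ?app_right using c(2)[OF 2(2)] by simp
  have "poly_subst (\<lambda>j. var (\<sigma> (0 + j))) r = poly_subst (pair (var u) (var v)) r"
    by (rule eq) (simp_all add: s)
  then have "act free_operad 3 \<sigma> (pcomp free_operad 2 2 0 ?g r) = app g (poly_subst (pair (var u) (var v)) r) (var w)"
    unfolding act_free_operad pcomp_free_operad[OF g 2(1)] poly_subst_poly_subst poly_subst_app poly_subst_var
    by (simp add: s poly_subst_poly_subst)
  then show ?app_left using c(2)[OF 2(1)] by simp
qed

lemma gen_ideal_permute_vars:
  fixes r :: "'g tree \<Rightarrow>\<^sub>0 'k :: comm_ring_1"
  assumes R: "\<And>n. R n \<subseteq> Ops free_operad n" and r: "r \<in> gen_ideal free_operad R 3"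
    and uvw: "distinct [u, v, w]" "u < 3" "v < 3" "w < 3"
  shows "poly_subst (\<lambda>j. var ([u, v, w] ! j)) r \<in> gen_ideal free_operad R 3"
proof -
  interpret I: operad_ideal free_operad "gen_ideal free_operad R"
    by (rule operad.operad_ideal_gen_ideal[OF operad_free R])
  obtain \<sigma> where \<sigma>: "\<sigma> permutes {..<3}" and s: "\<sigma> 0 = u" "\<sigma> 1 = v" "\<sigma> 2 = w"
    using vars_permutation[OF uvw] by metis
  have "\<sigma> j = [u, v, w] ! j" if "j < 3" for j
    using that s by (auto simp: numeral_3_eq_3 numeral_2_eq_2 less_Suc_eq)
  then have "act free_operad 3 \<sigma> r = poly_subst (\<lambda>j. var ([u, v, w] ! j)) r"
    unfolding act_free_operad using I.ideal_closed[OF r]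
    by (intro poly_subst_cong[of _ "{..<3}"]) (simp_all add: Ops_free_operad)
  then show ?thesis using I.ideal_act[OF r \<sigma>] by simp
qed

section \<open>The change of generators\<close>

text \<open>The sign picked up when the arguments are exchanged; it lets one rule treat the
  commutative and the skew generators alike.\<close>

definition gen_sign :: "pois_gen \<Rightarrow> 'k :: comm_ring_1" where
  "gen_sign s = (case s of Dot \<Rightarrow> 1 | _ \<Rightarrow> - 1)"

lemma LL_symmetry:
  "app s (var 0) (var 1) - scale (gen_sign s) (app s (var 1) (var 0)) \<in> gen_ideal free_operad (LL_rels h1 h2) 2"
proof -
  have m: "scale (- 1) p = - p" for p :: "pois_gen tree \<Rightarrow>\<^sub>0 'a"
    by (rule poly_mapping_eqI) simp
  show ?thesis
    unfolding gen_ideal_def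
    by (cases s) (auto simp: gen_sign_def LL_rels_def Let_def m intro!: in_gen_ideal.base)
qed

text \<open>These rules allow the inner node of a tree with three leaves to be moved to the right of
  the root and its two labels to be sorted. Hence \<open>f\<close> is determined on such trees by 27
  values: three outer labels times nine pairs of generators.\<close>

lemma LL_functional_symmetry:
  fixes f :: "(pois_gen tree \<Rightarrow>\<^sub>0 'k :: field) \<Rightarrow> 'k"
  assumes f: "Vector_Spaces.linear scale (*) f"
    and f0: "\<forall>y \<in> gen_ideal free_operad (LL_rels h1 h2) 3. f y = 0"
    and uvw: "distinct [u, v, w]" "u < 3" "v < 3" "w < 3"
  shows "f (app g (var u) (app s (var v) (var w))) = gen_sign s * f (app g (var u) (app s (var w) (var v)))"
    and "f (app s (app g (var u) (var v)) (var w)) = gen_sign s * f (app s (var w) (app g (var u) (var v)))"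
proof -
  interpret f: Vector_Spaces.linear scale "(*)" f by (rule f)
  note simps = poly_subst_linear app_expand f.add f.diff f.scale pair_def
  show "f (app g (var u) (app s (var v) (var w))) = gen_sign s * f (app g (var u) (app s (var w) (var v)))"
    using bspec[OF f0 gen_ideal_app_right[OF rels_in_free_operad(1) LL_symmetry uvw, of g]] by (simp add: simps)
  show "f (app s (app g (var u) (var v)) (var w)) = gen_sign s * f (app s (var w) (app g (var u) (var v)))"
    using bspec[OF f0 gen_ideal_subst_left[OF rels_in_free_operad(1) LL_symmetry uvw, of g]] by (simp add: simps)
qed


lemma LL_functional_rels:
  fixes f :: "(pois_gen tree \<Rightarrow>\<^sub>0 'k :: field) \<Rightarrow> 'k"
  assumes f: "Vector_Spaces.linear scale (*) f"
    and f0: "\<forall>y \<in> gen_ideal free_operad (LL_rels h1 h2) 3. f y = 0"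
    and uvw: "distinct [u, v, w]" "u < 3" "v < 3" "w < 3"
  defines "a \<equiv> var u" and "b \<equiv> var v" and "c \<equiv> var w"
  shows "f (app Brack (app Dot a b) c) = f (app Dot a (app Brack b c)) + f (app Dot (app Brack a c) b)"
    and "f (app Brace (app Dot a b) c) = f (app Dot a (app Brace b c)) + f (app Dot (app Brace a c) b)"
    and "f (app Brace a (app Brace b c)) + f (app Brace b (app Brace c a)) + f (app Brace c (app Brace a b)) = 0"
    and "f (app Brack a (app Brack b c)) + f (app Brack b (app Brack c a)) + f (app Brack c (app Brack a b)) = 0"
    and "f (app Brace a (app Brack b c)) + f (app Brace b (app Brack c a)) + f (app Brace c (app Brack a b))
      + f (app Brack a (app Brace b c)) + f (app Brack b (app Brace c a)) + f (app Brack c (app Brace a b)) = 0"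
    and "f (app Dot (app Dot a b) c) - f (app Dot a (app Dot b c))
      = h1\<^sup>2 * f (app Brack b (app Brack a c))
      + h1 * h2 * (f (app Brack b (app Brace a c)) + f (app Brace b (app Brack a c)))
      + h2\<^sup>2 * f (app Brace b (app Brace a c))"
proof -
  interpret f: Vector_Spaces.linear scale "(*)" f by (rule f)
  have "\<forall>r \<in> LL_rels h1 h2 3. f (poly_subst (\<lambda>j. var ([u, v, w] ! j)) r) = 0"
    by (intro ballI bspec[OF f0] gen_ideal_permute_vars[OF rels_in_free_operad(1) _ uvw])
       (simp add: gen_ideal_def in_gen_ideal.base)
  then show "f (app Brack (app Dot a b) c) = f (app Dot a (app Brack b c)) + f (app Dot (app Brack a c) b)"
    "f (app Brace (app Dot a b) c) = f (app Dot a (app Brace b c)) + f (app Dot (app Brace a c) b)"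
    "f (app Brace a (app Brace b c)) + f (app Brace b (app Brace c a)) + f (app Brace c (app Brace a b)) = 0"
    "f (app Brack a (app Brack b c)) + f (app Brack b (app Brack c a)) + f (app Brack c (app Brack a b)) = 0"
    "f (app Brace a (app Brack b c)) + f (app Brace b (app Brack c a)) + f (app Brace c (app Brack a b))
      + f (app Brack a (app Brace b c)) + f (app Brack b (app Brace c a)) + f (app Brack c (app Brace a b)) = 0"
    "f (app Dot (app Dot a b) c) - f (app Dot a (app Dot b c))
      = h1\<^sup>2 * f (app Brack b (app Brack a c))
      + h1 * h2 * (f (app Brack b (app Brace a c)) + f (app Brace b (app Brack a c)))
      + h2\<^sup>2 * f (app Brace b (app Brace a c))"
    by (simp_all add: LL_rels_def Let_def a_def b_def c_def poly_subst_linear f.add f.diff f.scale)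
qed

section \<open>The relations of \<open>Ass2\<close> inside the Livernet-Loday operad\<close>

text \<open>
  The coefficients \<open>a\<close>, \<open>b\<close> are meant to satisfy \<open>h1 * b - h2 * a = 1\<close>, so that \<open>[,]\<close> and \<open>{,}\<close> can be
  recovered from \<open>h1 [,] + h2 {,}\<close> and \<open>a [,] + b {,}\<close>; below, \<open>c\<close> is meant to be one half.
\<close>

definition Ass2_to_LL :: "'k :: comm_ring_1 \<Rightarrow> 'k \<Rightarrow> 'k \<Rightarrow> 'k \<Rightarrow> ass2_gen \<Rightarrow> pois_gen tree \<Rightarrow>\<^sub>0 'k" where
  "Ass2_to_LL h1 h2 a b g = (case g of
      Star \<Rightarrow> app Dot (var 0) (var 1) + (scale h1 (app Brack (var 0) (var 1)) + scale h2 (app Brace (var 0) (var 1)))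
    | Bracket \<Rightarrow> scale a (app Brack (var 0) (var 1)) + scale b (app Brace (var 0) (var 1)))"

lemma app_var_closed:
  "app g (var 0) (var (Suc 0)) \<in> Ops free_operad 2" "app g (var (Suc 0)) (var 0) \<in> Ops free_operad 2"
  by (auto simp: app_monom var_def free_operad_def trees_def)

lemma Ass2_to_LL_closed: "Ass2_to_LL h1 h2 a b g \<in> Ops free_operad 2"
  by (cases g) (auto simp: Ass2_to_LL_def intro!: free_operad_closed app_var_closed)

text \<open>The images of the arguments are named in premises because each occurs several times on
  the right.\<close>

lemma free_hom_Ass2_to_LL:
  "free_hom (Ass2_to_LL h1 h2 a b) (app Star p q) = app Dot p' q' + (scale h1 (app Brack p' q') + scale h2 (app Brace p' q'))"
  "free_hom (Ass2_to_LL h1 h2 a b) (app Bracket p q) = scale a (app Brack p' q') + scale b (app Brace p' q')"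
  if "p' = free_hom (Ass2_to_LL h1 h2 a b) p" "q' = free_hom (Ass2_to_LL h1 h2 a b) q"
  using that
  by (simp_all add: free_hom_app Ass2_to_LL_closed) (simp_all add: Ass2_to_LL_def poly_subst_linear pair_def)

lemma free_hom_Ass2_rels_2:
  fixes h1 :: "'k :: field"
  assumes "r \<in> Ass2_rels 2"
  shows "free_hom (Ass2_to_LL h1 h2 a b) r \<in> gen_ideal free_operad (LL_rels h1 h2) 2"
proof (rule gen_ideal_functionalI)
  fix f :: "_ \<Rightarrow> 'k" assume f: "Vector_Spaces.linear scale (*) f"
    and f0: "\<forall>y \<in> gen_ideal free_operad (LL_rels h1 h2) 2. f y = 0"
  interpret f: Vector_Spaces.linear scale "(*)" f by (rule f)
  have "f (app s (var 0) (var 1)) = gen_sign s * f (app s (var 1) (var 0))" for s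
    using bspec[OF f0 LL_symmetry[of s]] by (simp add: f.diff f.scale)
  note sym = this[of Brack, simplified] this[of Brace, simplified]
  show "f (free_hom (Ass2_to_LL h1 h2 a b) r) = 0"
    using assms by (simp add: Ass2_rels_def Let_def free_hom_linear free_hom_Ass2_to_LL f.add f.diff f.scale sym gen_sign_def)
qed

text \<open>Symmetrizing the image of \<open>Star\<close> gives twice the dot, so the third relation
  is the Leibniz rule for the second bracket. Antisymmetrizing gives twice h1 [,] + h2 {,}, so the
  fourth is twice its compatibility with the second bracket; this and the Jacobi identity are
  combinations of (iii), (iv), (v).\<close>

lemma free_hom_Ass2_rels_3:
  fixes h1 :: "'k :: field"
  assumes "r \<in> Ass2_rels 3"
  shows "free_hom (Ass2_to_LL h1 h2 a b) r \<in> gen_ideal free_operad (LL_rels h1 h2) 3"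
proof (rule gen_ideal_functionalI)
  fix f :: "_ \<Rightarrow> 'k" assume f: "Vector_Spaces.linear scale (*) f"
    and f0: "\<forall>y \<in> gen_ideal free_operad (LL_rels h1 h2) 3. f y = 0"
  interpret f: Vector_Spaces.linear scale "(*)" f by (rule f)
  note sym = LL_functional_symmetry[OF f f0]
  note rels = LL_functional_rels[OF f f0]
  \<comment> \<open>Exchanging only decreasing labels makes the symmetry a terminating rewrite
    rule.\<close>
  have order: "f (app g (var u) (app s (var w) (var v))) = gen_sign s * f (app g (var u) (app s (var v) (var w)))"
    if "v < w" "distinct [u, w, v]" "u < 3" "v < 3" "w < 3" for s g u v w
    by (rule sym(1)[OF that(2,3,5,4)])
  note normalize = sym(2) order gen_sign_def
  \<comment> \<open>The products that remain under a bracket are those of variables 0, 1 (bracketed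
    with 2) and of 1, 2 (bracketed with 0); these are the two instances of the Leibniz
    rules.\<close>
  note r = rels[of 0 1 2, simplified] rels(1,2)[of 1 2 0, simplified]
  have "\<forall>r \<in> Ass2_rels 3. f (free_hom (Ass2_to_LL h1 h2 a b) r) = 0"
    by (simp add: Ass2_rels_def Let_def free_hom_linear free_hom_Ass2_to_LL f.add f.diff f.scale
        app_expand normalize; intro conjI; insert r, simp (no_asm_use) add: normalize, algebra)
  then show "f (free_hom (Ass2_to_LL h1 h2 a b) r) = 0" using assms by blast
qed

section \<open>The Livernet-Loday relations inside \<open>Ass2\<close>\<close>

text \<open>Here \<open>c\<close> times \<open>S - S'\<close> stands for h1 [,] + h2 {,} and
  \<open>L\<close> for a [,] + b {,}. The remaining coefficients are the entries of the inverse of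
  the matrix with rows (h1, h2) and (a, b), of determinant one.\<close>

definition LL_to_Ass2 :: "'k :: comm_ring_1 \<Rightarrow> 'k \<Rightarrow> 'k \<Rightarrow> 'k \<Rightarrow> 'k \<Rightarrow> pois_gen \<Rightarrow> ass2_gen tree \<Rightarrow>\<^sub>0 'k" where
  "LL_to_Ass2 h1 h2 a b c g =
    (let S = app Star (var 0) (var 1); S' = app Star (var 1) (var 0); L = app Bracket (var 0) (var 1)
     in case g of
      Dot \<Rightarrow> scale c (S + S')
    | Brack \<Rightarrow> scale (b * c) (S - S') - scale h2 L
    | Brace \<Rightarrow> scale h1 L - scale (a * c) (S - S'))"

lemma LL_to_Ass2_closed: "LL_to_Ass2 h1 h2 a b c g \<in> Ops free_operad 2"
  by (cases g) (auto simp: LL_to_Ass2_def Let_def intro!: free_operad_closed app_var_closed)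

lemma free_hom_LL_to_Ass2:
  fixes h1 h2 a b c :: "'k :: comm_ring_1"
  assumes "p' = free_hom (LL_to_Ass2 h1 h2 a b c) p" "q' = free_hom (LL_to_Ass2 h1 h2 a b c) q"
  shows "free_hom (LL_to_Ass2 h1 h2 a b c) (app Dot p q) = scale c (app Star p' q' + app Star q' p')"
    and "free_hom (LL_to_Ass2 h1 h2 a b c) (app Brack p q)
      = scale (b * c) (app Star p' q' - app Star q' p') - scale h2 (app Bracket p' q')"
    and "free_hom (LL_to_Ass2 h1 h2 a b c) (app Brace p q)
      = scale h1 (app Bracket p' q') - scale (a * c) (app Star p' q' - app Star q' p')"
  using assms
  by (simp_all add: free_hom_app LL_to_Ass2_closed)
     (simp_all add: LL_to_Ass2_def Let_def poly_subst_linear pair_def)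

lemma Ass2_skew:
  "app Bracket (var 0) (var 1) + app Bracket (var 1) (var 0) \<in> gen_ideal free_operad Ass2_rels 2"
  unfolding gen_ideal_def by (auto simp: Ass2_rels_def Let_def intro!: in_gen_ideal.base)

text \<open>\<open>Star\<close> has no symmetry, so a bracket inside it cannot be moved to the other
  side; inner brackets have to be sorted on both sides of the root.\<close>

lemma Ass2_functional_skew:
  fixes f :: "(ass2_gen tree \<Rightarrow>\<^sub>0 'k :: field) \<Rightarrow> 'k"
  assumes f: "Vector_Spaces.linear scale (*) f"
    and f0: "\<forall>y \<in> gen_ideal free_operad Ass2_rels 3. f y = 0"
    and uvw: "distinct [u, v, w]" "u < 3" "v < 3" "w < 3"
  shows "f (app g (var u) (app Bracket (var v) (var w))) = - f (app g (var u) (app Bracket (var w) (var v)))"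
    and "f (app g (app Bracket (var u) (var v)) (var w)) = - f (app g (app Bracket (var v) (var u)) (var w))"
    and "f (app Bracket (app g (var u) (var v)) (var w)) = - f (app Bracket (var w) (app g (var u) (var v)))"
proof -
  interpret f: Vector_Spaces.linear scale "(*)" f by (rule f)
  note simps = poly_subst_linear app_expand f.add pair_def eq_neg_iff_add_eq_0
  note skew = rels_in_free_operad(3) Ass2_skew uvw
  show "f (app g (var u) (app Bracket (var v) (var w))) = - f (app g (var u) (app Bracket (var w) (var v)))"
    using bspec[OF f0 gen_ideal_app_right[OF skew, of g]] by (simp add: simps)
  show "f (app g (app Bracket (var u) (var v)) (var w)) = - f (app g (app Bracket (var v) (var u)) (var w))"
    using bspec[OF f0 gen_ideal_app_left[OF skew, of g]] by (simp add: simps)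
  show "f (app Bracket (app g (var u) (var v)) (var w)) = - f (app Bracket (var w) (app g (var u) (var v)))"
    using bspec[OF f0 gen_ideal_subst_left[OF skew, of g]] by (simp add: simps)
qed

lemma Ass2_functional_rels:
  fixes f :: "(ass2_gen tree \<Rightarrow>\<^sub>0 'k :: field) \<Rightarrow> 'k"
  assumes f: "Vector_Spaces.linear scale (*) f"
    and f0: "\<forall>y \<in> gen_ideal free_operad Ass2_rels 3. f y = 0"
    and uvw: "distinct [u, v, w]" "u < 3" "v < 3" "w < 3"
  defines "a \<equiv> var u" and "b \<equiv> var v" and "c \<equiv> var w"
  shows "f (app Star (app Star a b) c) = f (app Star a (app Star b c))"
    and "f (app Bracket a (app Bracket b c)) + f (app Bracket b (app Bracket c a)) + f (app Bracket c (app Bracket a b)) = 0"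
    and "f (app Bracket a (app Star b c)) + f (app Bracket a (app Star c b))
      = f (app Star (app Bracket a b) c) + f (app Star b (app Bracket a c))
        + f (app Star (app Bracket a c) b) + f (app Star c (app Bracket a b))"
    and "f (app Bracket a (app Star b c)) - f (app Bracket a (app Star c b))
      + (f (app Bracket b (app Star c a)) - f (app Bracket b (app Star a c)))
      + (f (app Bracket c (app Star a b)) - f (app Bracket c (app Star b a)))
      + f (app Star a (app Bracket b c)) - f (app Star (app Bracket b c) a)
      + f (app Star b (app Bracket c a)) - f (app Star (app Bracket c a) b)
      + f (app Star c (app Bracket a b)) - f (app Star (app Bracket a b) c) = 0"
proof -
  interpret f: Vector_Spaces.linear scale "(*)" f by (rule f)
  have "\<forall>r \<in> Ass2_rels 3. f (poly_subst (\<lambda>j. var ([u, v, w] ! j)) r) = 0"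
    by (intro ballI bspec[OF f0] gen_ideal_permute_vars[OF rels_in_free_operad(3) _ uvw])
       (simp add: gen_ideal_def in_gen_ideal.base)
  then show "f (app Star (app Star a b) c) = f (app Star a (app Star b c))"
    "f (app Bracket a (app Bracket b c)) + f (app Bracket b (app Bracket c a)) + f (app Bracket c (app Bracket a b)) = 0"
    "f (app Bracket a (app Star b c)) + f (app Bracket a (app Star c b))
      = f (app Star (app Bracket a b) c) + f (app Star b (app Bracket a c))
        + f (app Star (app Bracket a c) b) + f (app Star c (app Bracket a b))"
    "f (app Bracket a (app Star b c)) - f (app Bracket a (app Star c b))
      + (f (app Bracket b (app Star c a)) - f (app Bracket b (app Star a c)))
      + (f (app Bracket c (app Star a b)) - f (app Bracket c (app Star b a)))
      + f (app Star a (app Bracket b c)) - f (app Star (app Bracket b c) a)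
      + f (app Star b (app Bracket c a)) - f (app Star (app Bracket c a) b)
      + f (app Star c (app Bracket a b)) - f (app Star (app Bracket a b) c) = 0"
    by (simp_all add: Ass2_rels_def Let_def a_def b_def c_def poly_subst_linear app_expand f.add f.diff)
qed

lemma free_hom_LL_rels_2:
  fixes h1 :: "'k :: field"
  assumes "r \<in> LL_rels h1 h2 2"
  shows "free_hom (LL_to_Ass2 h1 h2 a b c) r \<in> gen_ideal free_operad Ass2_rels 2"
proof (rule gen_ideal_functionalI)
  fix f :: "_ \<Rightarrow> 'k" assume f: "Vector_Spaces.linear scale (*) f"
    and f0: "\<forall>y \<in> gen_ideal free_operad Ass2_rels 2. f y = 0"
  interpret f: Vector_Spaces.linear scale "(*)" f by (rule f)
  have skew: "f (app Bracket (var 0) (var (Suc 0))) = - f (app Bracket (var (Suc 0)) (var 0))"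
    using bspec[OF f0 Ass2_skew] by (simp add: f.add eq_neg_iff_add_eq_0)
  have "\<forall>r \<in> LL_rels h1 h2 2. f (free_hom (LL_to_Ass2 h1 h2 a b c) r) = 0"
    by (simp add: LL_rels_def Let_def free_hom_linear free_hom_LL_to_Ass2 f.add f.diff f.scale skew;
        intro conjI; algebra)
  then show "f (free_hom (LL_to_Ass2 h1 h2 a b c) r) = 0" using assms by blast
qed

text \<open>The commutator of an associative product is a derivation and satisfies the Jacobi
  identity. Together with the relations for the second bracket this gives (i)-(v) as combinations,
  the fourth relation of \<open>Ass2\<close> supplying the mixed terms.\<close>

lemma free_hom_LL_rels_3:
  fixes h1 :: "'k :: field"
  assumes det: "h1 * b - h2 * a = 1" and "r \<in> LL_rels h1 h2 3"
  shows "free_hom (LL_to_Ass2 h1 h2 a b c) r \<in> gen_ideal free_operad Ass2_rels 3"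
proof (rule gen_ideal_functionalI)
  fix f :: "_ \<Rightarrow> 'k" assume f: "Vector_Spaces.linear scale (*) f"
    and f0: "\<forall>y \<in> gen_ideal free_operad Ass2_rels 3. f y = 0"
  interpret f: Vector_Spaces.linear scale "(*)" f by (rule f)
  note skew = Ass2_functional_skew[OF f f0]
  note rels = Ass2_functional_rels[OF f f0]
  have order_right: "f (app g (var u) (app Bracket (var w) (var v))) = - f (app g (var u) (app Bracket (var v) (var w)))"
    if "v < w" "distinct [u, w, v]" "u < 3" "v < 3" "w < 3" for g u v w
    by (rule skew(1)[OF that(2,3,5,4)])
  have order_left: "f (app g (app Bracket (var w) (var v)) (var u)) = - f (app g (app Bracket (var v) (var w)) (var u))"
    if "v < w" "distinct [w, v, u]" "u < 3" "v < 3" "w < 3" for g u v w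
    by (rule skew(2)[OF that(2,5,4,3)])
  note normalize = order_right order_left skew(3) rels(1)
  \<comment> \<open>In (i) and (ii) the product of the variables 0 and 1 is bracketed with variable
    2, hence this order of the variables.\<close>
  note leibniz = rels(3)[of 2 0 1, simplified]
  note lie = rels(2,4)[of 0 1 2, simplified]
  have "\<forall>r \<in> LL_rels h1 h2 3. f (free_hom (LL_to_Ass2 h1 h2 a b c) r) = 0"
    apply (simp add: LL_rels_def Let_def free_hom_linear free_hom_LL_to_Ass2 f.add f.diff f.scale
        app_expand normalize; intro conjI)
    subgoal using leibniz by (simp (no_asm_use) add: normalize) algebra
    subgoal using leibniz by (simp (no_asm_use) add: normalize) algebra
    subgoal using lie by (simp (no_asm_use) add: normalize) algebra
    subgoal using lie by (simp (no_asm_use) add: normalize) algebra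
    subgoal using lie by (simp (no_asm_use) add: normalize) algebra
    \<comment> \<open>\<open>h1\<close> times \<open>Brack\<close> plus \<open>h2\<close> times
      \<open>Brace\<close> goes to (h1 b - h2 a) c (S - S') = c (S - S'), so (vi) becomes
      \<open>c\<close> squared times the classical identity between associator and double
      commutator.\<close>
    subgoal using det by algebra
    done
  then show "f (free_hom (LL_to_Ass2 h1 h2 a b c) r) = 0" using assms by blast
qed

section \<open>The two substitutions as mutual inverses\<close>

text \<open>The composite replaces each operation by its symmetric or skew part, for instance the
  dot by its average over both orders; the symmetry relations identify these parts with the
  generators.\<close>

lemma free_hom_free_hom_LL:
  fixes h1 :: "'k :: field"
  assumes det: "h1 * b - h2 * a = 1" and half: "2 * c = 1"
  shows "free_hom (Ass2_to_LL h1 h2 a b) (LL_to_Ass2 h1 h2 a b c g) - app g (var 0) (var 1)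
    \<in> gen_ideal free_operad (LL_rels h1 h2) 2"
proof (rule gen_ideal_functionalI)
  fix f :: "_ \<Rightarrow> 'k" assume f: "Vector_Spaces.linear scale (*) f"
    and f0: "\<forall>y \<in> gen_ideal free_operad (LL_rels h1 h2) 2. f y = 0"
  interpret f: Vector_Spaces.linear scale "(*)" f by (rule f)
  have "f (app s (var 0) (var (Suc 0))) = gen_sign s * f (app s (var (Suc 0)) (var 0))" for s
    using bspec[OF f0 LL_symmetry[of s]] by (simp add: f.diff f.scale)
  note sym = this[of Dot] this[of Brack] this[of Brace]
  note sym = sym[unfolded gen_sign_def pois_gen.case]
  show "f (free_hom (Ass2_to_LL h1 h2 a b) (LL_to_Ass2 h1 h2 a b c g) - app g (var 0) (var 1)) = 0"
    by (induct g; simp add: LL_to_Ass2_def Let_def free_hom_linear free_hom_Ass2_to_LL f.add f.diff f.scale;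
        insert det half sym, algebra)
qed

text \<open>The difference is already zero in the free operad: \<open>Star\<close> goes to c (S +
  S') + (h1 b - h2 a) c (S - S') = 2 c S, and \<open>Bracket\<close> to (h1 b - h2 a) L.\<close>

lemma free_hom_free_hom_Ass2:
  fixes h1 :: "'k :: field"
  assumes det: "h1 * b - h2 * a = 1" and half: "2 * c = 1"
  shows "free_hom (LL_to_Ass2 h1 h2 a b c) (Ass2_to_LL h1 h2 a b g) - app g (var 0) (var 1)
    \<in> gen_ideal free_operad Ass2_rels 2"
proof (rule gen_ideal_functionalI)
  fix f :: "(ass2_gen tree \<Rightarrow>\<^sub>0 'k) \<Rightarrow> 'k" assume "Vector_Spaces.linear scale (*) f"
  then interpret f: Vector_Spaces.linear scale "(*)" f .
  show "f (free_hom (LL_to_Ass2 h1 h2 a b c) (Ass2_to_LL h1 h2 a b g) - app g (var 0) (var 1)) = 0"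
    by (induct g; simp add: Ass2_to_LL_def free_hom_linear free_hom_LL_to_Ass2 f.add f.diff f.scale;
        insert det half, algebra)
qed

lemma LL_isomorphic_Ass2:
  fixes h1 h2 :: "'k :: field_char_0"
  assumes "(h1, h2) \<noteq> (0, 0)"
  shows "operad_isomorphic (LL h1 h2) (Ass2 :: ('k, _) operad)"
proof -
  obtain a b where det: "h1 * b - h2 * a = 1"
  proof (cases "h1 = 0")
    case True
    \<comment> \<open>The arguments come in the order in which the unknowns occur in the equation:
      \<open>b = 0\<close> and \<open>a = - inverse h2\<close>. In the other case
      \<open>b = inverse h1\<close> and \<open>a = 0\<close>.\<close>
    then show ?thesis using assms by (intro that[of 0 "- inverse h2"]) simp
  next
    case False
    then show ?thesis by (intro that[of "inverse h1" 0]) simp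
  qed
  have half: "2 * inverse 2 = (1 :: 'k)" by simp
  have rels: "LL_rels h1 h2 n = {} \<and> Ass2_rels n = ({} :: (_ \<Rightarrow>\<^sub>0 'k) set)" if "n \<noteq> 2" "n \<noteq> 3" for n
    using that by (simp add: LL_rels_def Ass2_rels_def)
  show ?thesis
    unfolding LL_def Ass2_def
  proof (rule presented_operad_isomorphicI[where \<phi> = "LL_to_Ass2 h1 h2 a b (inverse 2)"
        and \<psi> = "Ass2_to_LL h1 h2 a b"])
    show "free_hom (LL_to_Ass2 h1 h2 a b (inverse 2)) r \<in> gen_ideal free_operad Ass2_rels n"
      if "r \<in> LL_rels h1 h2 n" for n r
      using that rels[of n] free_hom_LL_rels_2 free_hom_LL_rels_3[OF det]
      by (cases "n = 2"; cases "n = 3") auto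
    show "free_hom (Ass2_to_LL h1 h2 a b) r \<in> gen_ideal free_operad (LL_rels h1 h2) n"
      if "r \<in> Ass2_rels n" for n r
      using that rels[of n] free_hom_Ass2_rels_2 free_hom_Ass2_rels_3
      by (cases "n = 2"; cases "n = 3") auto
  qed (intro rels_in_free_operad LL_to_Ass2_closed Ass2_to_LL_closed
      free_hom_free_hom_LL[OF det half] free_hom_free_hom_Ass2[OF det half])+
qed

text \<open>At the origin the right side of (vi) vanishes and (vi) is associativity, so both operads
  have the same relations and are equal.\<close>

lemma LL_zero: "LL 0 0 = (P2 :: ('k :: comm_ring_1, _) operad)"
proof -
  have "LL_rels 0 0 = (P2_rels :: nat \<Rightarrow> (_ \<Rightarrow>\<^sub>0 'k) set)"
    by (rule ext) (auto simp: LL_rels_def P2_rels_def Let_def)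
  then show ?thesis by (simp add: LL_def P2_def)
qed

theorem proposition5:
  fixes h1 h2 :: "'k :: field_char_0"
  shows "((h1, h2) \<noteq> (0, 0) \<longrightarrow> operad_isomorphic (LL h1 h2) (Ass2 :: ('k, _) operad)) \<and>
    ((h1, h2) = (0, 0) \<longrightarrow> operad_isomorphic (LL h1 h2) (P2 :: ('k, _) operad))"
  by (auto simp: LL_zero operad_isomorphic_refl intro: LL_isomorphic_Ass2)

end
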